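(* Let $l,m\in\mathbb Z_+$ with $n=l+m\ge1$, and let $\mathbf s=\mathbf s_{\min}=(\underbrace{-,\dots,-}_{l},\underbrace{+,\dots,+}_{m})$. Then $\psi(v)=\psi_{\mathfrak a}(v)$ for all $v\in\widehat{\mathbb T}^n_{\mathbf s}$, and $T_\lambda=T^{\mathfrak a}_\lambda$ for all $\lambda\in\Lambda_{\underline{\mathbb Z}}$ with $\mathrm{sgn}(\lambda)=\mathbf s$.
   Context: **Type $C$ quantum group.** $\underline{\mathbb Z}=\tfrac12+\mathbb Z$; $\underline{\mathbb Z}_+$ is its set of positive elements; $\mathbb Z_+=\{0,1,2,\dots\}$. $P=\bigoplus_{r\in\underline{\mathbb Z}_+}\mathbb Z\delta_r$ with orthonormal basis $\delta_r$; $\delta_{-r}:=-\delta_r$. Simple roots: $\alpha_0=-2\delta_{1/2}$, $\alpha_i=\delta_{i-1/2}-\delta_{i+1/2}$ $(i\ge1)$; $Q^+=\sum_{i\ge0}\mathbb Z_+\alpha_i$; $f\ge g$ iff $f-g\in Q^+$. $\mathbf U=\mathbf U_q(\mathfrak c_\infty)$ is the quantum group over $\mathbb Q(q)$ with generators $E_i,F_i,K_i^{\pm1}$ $(i\ge0)$ and the standard relations, with $K_iE_jK_i^{-1}=q^{(\alpha_i,\alpha_j)}E_j$, $[E_i,F_j]=\delta_{ij}(K_i-K_i^{-1})/(q_i-q_i^{-1})$, $q_i=q^{(\alpha_i,\alpha_i)/2}$. Comultiplication: $\Delta(E_i)=1\otimes E_i+E_i\otimes K_i^{-1}$, $\Delta(F_i)=K_i\otimes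 F_i+F_i\otimes1$, $\Delta(K_i)=K_i\otimes K_i$. Bar involution on $\mathbf U$: $\overline q=q^{-1}$, $\overline{E_i}=E_i$, $\overline{F_i}=F_i$, $\overline{K_i}=K_i^{-1}$. **Tensor space.** $\mathbb V=\bigoplus_{r\in\underline{\mathbb Z}}\mathbb Q(q)v_r$ is the natural $\mathbf U$-module: $E_0v_r=\delta_{r,\frac12}v_{-\frac12}$, $F_0v_r=\delta_{r,-\frac12}v_{\frac12}$, and for $i\ge1$: $E_iv_r=\delta_{r,i+\frac12}v_{i-\frac12}+\delta_{r,-i+\frac12}v_{-i-\frac12}$, $F_iv_r=\delta_{r,i-\frac12}v_{i+\frac12}+\delta_{r,-i-\frac12}v_{-i+\frac12}$; $K_iv_r=q^{(\alpha_i,\delta_r)}v_r$ (Kronecker deltas carry two subscripts). $\mathbb T^n=\mathbb V^{\otimes n}$, $\Lambda_{\underline{\mathbb Z}}=\underline{\mathbb Z}^n$, $M_\lambda=v_{\lambda_1}\otimes\cdots\otimes v_{\lambda_n}$. Bruhat order: $\lambda\succeq\mu$ iff $\sum_{i=r}^n\delta_{\lambda_i}\ge\sum_{i=r}^n\delta_{\mu_i}$ for all $1\le r\le n$, with equality for $r=1$. $\widehat{\mathbb T}^n$ is the space spanned by the possibly infinite formal sums $M_\lambda+\sum_{\mu\prec\lambda}c_\mu M_\mu$, $c_\mu\in\mathbb Q(q)$. For $\mathbf s\in\{+,-\}^n$, $\widehat{\mathbb T}^n_{\mathbf s}\subset\widehat{\mathbb T}^n$ is the subspace of elements involving only $M_\lambda$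 with $\mathrm{sgn}(\lambda)=\mathbf s$, where $\mathrm{sgn}(\lambda)$ is the sequence of signs of $\lambda_1,\dots,\lambda_n$. **Bar involutions and canonical bases.** For $k\ge1$ let $\Theta^{(k)}=\sum_{\nu}\Theta_\nu$ (sum over $\nu\in\sum_{0\le i\le k-1}\mathbb Z_+\alpha_i$, $\Theta_\nu\in\mathbf U^+_\nu\otimes\mathbf U^-_\nu$, $\Theta_0=1\otimes1$) be the quasi-$\mathcal R$-matrix of the subalgebra generated by $E_i,F_i,K_i^{\pm1}$, $0\le i\le k-1$, characterized by $\Delta(u)\Theta^{(k)}=\Theta^{(k)}\overline{\Delta(\overline u)}$; let $\Theta^{(k)}_{\mathfrak a}=\sum_\nu\Theta_\nu$ over $\nu\in\sum_{1\le i\le k-1}\mathbb Z_+\alpha_i$, the quasi-$\mathcal R$-matrix of the type $A$ subalgebra with indices $1\le i\le k-1$. On $\mathbb T^n_{<k}=\mathrm{span}\{M_\lambda:|\lambda_i|<k\ \forall i\}$ let $\psi^{(k)}$ (resp. $\psi_{\mathfrak a}^{(k)}$) be the antilinear ($q\mapsto q^{-1}$) involution fixing each $v_r$ when $n=1$ and given inductively by $x\otimes y\mapsto\Theta^{(k)}(\psi^{(k)}(x)\otimes\psi^{(k)}(y))$ (resp. with $\Theta^{(k)}_{\mathfrak a},\psi_{\mathfrak a}^{(k)}$). The coefficientwise limits as $k\to\infty$ define an antilinear involution $\psi$ on $\widehat{\mathbb T}^n$ and an antilinear involution $\psi_{\mathfrak a}$ on each $\widehat{\mathbb T}^n_{\mathbf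 s}$. The type $C$ canonical basis $\{T_\lambda\}_{\lambda\in\Lambda_{\underline{\mathbb Z}}}$ is the unique $\psi$-invariant topological basis of $\widehat{\mathbb T}^n$ with $T_\lambda\in M_\lambda+\sum_{\mu\prec\lambda}q\mathbb Z[q]M_\mu$. The type $A$ canonical basis $\{T^{\mathfrak a}_\lambda:\mathrm{sgn}(\lambda)=\mathbf s\}$ is the unique $\psi_{\mathfrak a}$-invariant topological basis of $\widehat{\mathbb T}^n_{\mathbf s}$ with $T^{\mathfrak a}_\lambda\in M_\lambda+\sum_{\mu\prec\lambda,\ \mathrm{sgn}(\mu)=\mathbf s}q\mathbb Z[q]M_\mu$ (sums possibly infinite). *)

theory Defs
  imports
    "HOL-Computational_Algebra.Computational_Algebra"
    "HOL-Computational_Algebra.Field_as_Ring"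
    "HOL-Library.Poly_Mapping"
    "HOL-Library.Product_Plus"
begin

section \<open>The field of rational functions in q over the rationals\<close>

type_synonym Kq = "rat poly fract"

definition qq :: Kq where
  "qq = to_fract [:0, 1:]"

definition eval_qinv :: "rat poly \<Rightarrow> Kq" where
  "eval_qinv p = poly (map_poly (\<lambda>c. to_fract [:c:]) p) (inverse qq)"

text \<open>The field automorphism with \<open>q \<mapsto> q\<inverse>\<close>.\<close>

definition bar :: "Kq \<Rightarrow> Kq" where
  "bar x = eval_qinv (fst (quot_of_fract x)) / eval_qinv (snd (quot_of_fract x))"

text \<open>The subset \<open>q\<int>[q]\<close>.\<close>

definition qZq :: "Kq set" where
  "qZq = {qq * to_fract (map_poly of_int p) | p :: int poly. True}"


section \<open>Monoid algebras of words\<close>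

text \<open>
  Lists form the free monoid under concatenation, so \<open>'a list \<Rightarrow>\<^sub>0 Kq\<close> with its
  convolution product from \<^theory>\<open>HOL-Library.Poly_Mapping\<close> is the free associative algebra
  (equivalently, the tensor algebra of the vector space with basis \<open>'a\<close>), and
  \<open>('a list \<times> 'a list) \<Rightarrow>\<^sub>0 Kq\<close> is its tensor square.
\<close>

instantiation list :: (type) monoid_add
begin
definition zero_list :: "'a list" where "zero_list = []"
definition plus_list :: "'a list \<Rightarrow> 'a list \<Rightarrow> 'a list" where "plus_list xs ys = xs @ ys"
instance by standard (simp_all add: zero_list_def plus_list_def)
end

definition scale :: "Kq \<Rightarrow> ('a \<Rightarrow>\<^sub>0 Kq) \<Rightarrow> ('a \<Rightarrow>\<^sub>0 Kq)" where
  "scale c x = Poly_Mapping.map ((*) c) x"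

definition lin_ext :: "('a \<Rightarrow> ('b \<Rightarrow>\<^sub>0 Kq)) \<Rightarrow> ('a \<Rightarrow>\<^sub>0 Kq) \<Rightarrow> ('b \<Rightarrow>\<^sub>0 Kq)" where
  "lin_ext f x = (\<Sum>a\<in>Poly_Mapping.keys x. scale (Poly_Mapping.lookup x a) (f a))"

definition antilin_ext :: "('a \<Rightarrow> ('b \<Rightarrow>\<^sub>0 Kq)) \<Rightarrow> ('a \<Rightarrow>\<^sub>0 Kq) \<Rightarrow> ('b \<Rightarrow>\<^sub>0 Kq)" where
  "antilin_ext f x = (\<Sum>a\<in>Poly_Mapping.keys x. scale (bar (Poly_Mapping.lookup x a)) (f a))"

inductive_set ideal_gen :: "'a::ring_1 set \<Rightarrow> 'a set" for R :: "'a set" where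
  zero: "0 \<in> ideal_gen R"
| gen: "r \<in> R \<Longrightarrow> a * r * b \<in> ideal_gen R"
| add: "x \<in> ideal_gen R \<Longrightarrow> y \<in> ideal_gen R \<Longrightarrow> x + y \<in> ideal_gen R"


section \<open>Half-integers, weights and simple roots\<close>

typedef half = "{r :: rat. r - 1/2 \<in> \<int>}"
  morphisms hval hf
  by (rule exI[of _ "1/2"]) simp

text \<open>
  The weight lattice is the free abelian group on the positive half-integers, sitting inside the
  free abelian group on all half-integers.
\<close>

type_synonym wt = "half \<Rightarrow>\<^sub>0 int"

definition delta :: "half \<Rightarrow> wt" where
  "delta r = (if hval r > 0 then frag_of r else - frag_of (hf (- hval r)))"

definition form :: "wt \<Rightarrow> wt \<Rightarrow> int" where
  "form x y = (\<Sum>r\<in>Poly_Mapping.keys x. Poly_Mapping.lookup x r * Poly_Mapping.lookup y r)"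

definition alpha :: "nat \<Rightarrow> wt" where
  "alpha i = (if i = 0 then - frag_cmul 2 (delta (hf (1/2)))
              else delta (hf (of_nat i - 1/2)) - delta (hf (of_nat i + 1/2)))"

text \<open>
  Since the simple roots are linearly independent, the elements of \<open>Q\<^sup>+\<close> are indexed by their
  coefficient vectors, of type \<open>nat \<Rightarrow>\<^sub>0 nat\<close>.
\<close>

definition root_wt :: "(nat \<Rightarrow>\<^sub>0 nat) \<Rightarrow> wt" where
  "root_wt \<nu> = (\<Sum>i\<in>Poly_Mapping.keys \<nu>. frag_cmul (int (Poly_Mapping.lookup \<nu> i)) (alpha i))"

definition wt_ge :: "wt \<Rightarrow> wt \<Rightarrow> bool" where
  "wt_ge f g \<longleftrightarrow> (\<exists>\<nu>. f - g = root_wt \<nu>)"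


section \<open>The quantum group\<close>

text \<open>
  The quantum group is the quotient of the free algebra \<open>free_alg\<close> on the generators
  \<open>E\<^sub>i, F\<^sub>i, K\<^sub>i, K\<^sub>i\<inverse>\<close> by the two-sided ideal generated by \<open>relations\<close>; its tensor square is the
  quotient of \<open>free_alg2\<close> by \<open>ideal2\<close>.  Elements of the quotients are handled through
  representatives, and equality in the quotient is membership of the difference in the ideal.
\<close>

datatype gen = GE nat | GF nat | GK nat | GKi nat

type_synonym free_alg = "gen list \<Rightarrow>\<^sub>0 Kq"
type_synonym free_alg2 = "(gen list \<times> gen list) \<Rightarrow>\<^sub>0 Kq"

definition letter :: "gen \<Rightarrow> free_alg" where
  "letter g = Poly_Mapping.single [g] 1"

definition qi :: "nat \<Rightarrow> Kq" where
  "qi i = qq powi (form (alpha i) (alpha i) div 2)"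

definition cartan :: "nat \<Rightarrow> nat \<Rightarrow> int" where
  "cartan i j = (2 * form (alpha i) (alpha j)) div form (alpha i) (alpha i)"

definition qint :: "nat \<Rightarrow> nat \<Rightarrow> Kq" where
  "qint i m = (qi i powi int m - qi i powi (- int m)) / (qi i - inverse (qi i))"

definition qfact :: "nat \<Rightarrow> nat \<Rightarrow> Kq" where
  "qfact i m = (\<Prod>j=1..m. qint i j)"

definition qbinom :: "nat \<Rightarrow> nat \<Rightarrow> nat \<Rightarrow> Kq" where
  "qbinom i m s = qfact i m / (qfact i s * qfact i (m - s))"

definition serre :: "(nat \<Rightarrow> gen) \<Rightarrow> nat \<Rightarrow> nat \<Rightarrow> free_alg" where
  "serre X i j = (let m = nat (1 - cartan i j) in
     \<Sum>s=0..m. scale ((-1) ^ s * qbinom i m s) (letter (X i) ^ (m - s) * letter (X j) * letter (X i) ^ s))"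

definition relations :: "free_alg set" where
  "relations =
     {letter (GK i) * letter (GKi i) - 1 | i. True} \<union>
     {letter (GKi i) * letter (GK i) - 1 | i. True} \<union>
     {letter (GK i) * letter (GK j) - letter (GK j) * letter (GK i) | i j. True} \<union>
     {letter (GK i) * letter (GE j) * letter (GKi i)
        - scale (qq powi form (alpha i) (alpha j)) (letter (GE j)) | i j. True} \<union>
     {letter (GK i) * letter (GF j) * letter (GKi i)
        - scale (qq powi (- form (alpha i) (alpha j))) (letter (GF j)) | i j. True} \<union>
     {letter (GE i) * letter (GF j) - letter (GF j) * letter (GE i)
        - (if i = j then scale (inverse (qi i - inverse (qi i))) (letter (GK i) - letter (GKi i)) else 0)
        | i j. True} \<union>
     {serre GE i j | i j. i \<noteq> j} \<union>
     {serre GF i j | i j. i \<noteq> j}"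

definition tensor2 :: "free_alg \<Rightarrow> free_alg \<Rightarrow> free_alg2" where
  "tensor2 a b = (\<Sum>v\<in>Poly_Mapping.keys a. \<Sum>w\<in>Poly_Mapping.keys b.
     Poly_Mapping.single (v, w) (Poly_Mapping.lookup a v * Poly_Mapping.lookup b w))"

definition ideal2 :: "free_alg2 set" where
  "ideal2 = ideal_gen ((\<lambda>r. tensor2 r 1) ` relations \<union> (\<lambda>r. tensor2 1 r) ` relations)"

fun comul_gen :: "gen \<Rightarrow> free_alg2" where
  "comul_gen (GE i) = tensor2 1 (letter (GE i)) + tensor2 (letter (GE i)) (letter (GKi i))"
| "comul_gen (GF i) = tensor2 (letter (GK i)) (letter (GF i)) + tensor2 (letter (GF i)) 1"
| "comul_gen (GK i) = tensor2 (letter (GK i)) (letter (GK i))"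
| "comul_gen (GKi i) = tensor2 (letter (GKi i)) (letter (GKi i))"

definition comul :: "free_alg \<Rightarrow> free_alg2" where
  "comul = lin_ext (\<lambda>w. prod_list (map comul_gen w))"

fun bar_gen :: "gen \<Rightarrow> gen" where
  "bar_gen (GE i) = GE i"
| "bar_gen (GF i) = GF i"
| "bar_gen (GK i) = GKi i"
| "bar_gen (GKi i) = GK i"

definition bar_alg :: "free_alg \<Rightarrow> free_alg" where
  "bar_alg = antilin_ext (\<lambda>w. Poly_Mapping.single (map bar_gen w) 1)"

definition bar_alg2 :: "free_alg2 \<Rightarrow> free_alg2" where
  "bar_alg2 = antilin_ext (\<lambda>(v, w). Poly_Mapping.single (map bar_gen v, map bar_gen w) 1)"

fun gen_index :: "gen \<Rightarrow> nat" where
  "gen_index (GE i) = i"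
| "gen_index (GF i) = i"
| "gen_index (GK i) = i"
| "gen_index (GKi i) = i"

fun gen_deg :: "gen \<Rightarrow> wt" where
  "gen_deg (GE i) = alpha i"
| "gen_deg (GF i) = - alpha i"
| "gen_deg (GK i) = 0"
| "gen_deg (GKi i) = 0"

definition word_deg :: "gen list \<Rightarrow> wt" where
  "word_deg w = sum_list (map gen_deg w)"

definition subalg :: "nat \<Rightarrow> free_alg set" where
  "subalg k = {u. \<forall>w\<in>Poly_Mapping.keys u. \<forall>g\<in>set w. gen_index g < k}"

text \<open>Representatives of \<open>\<^bold>U\<^sup>+\<^sub>\<nu> \<otimes> \<^bold>U\<^sup>-\<^sub>\<nu>\<close>, where \<open>\<^bold>U\<^sup>-\<^sub>\<nu>\<close> has weight \<open>-\<nu>\<close>.\<close>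

definition pos_neg_part :: "(nat \<Rightarrow>\<^sub>0 nat) \<Rightarrow> free_alg2 set" where
  "pos_neg_part \<nu> = {t. \<forall>(v, w)\<in>Poly_Mapping.keys t.
     set v \<subseteq> range GE \<and> word_deg v = root_wt \<nu> \<and>
     set w \<subseteq> range GF \<and> word_deg w = - root_wt \<nu>}"


section \<open>The quasi-R-matrix\<close>

definition cone_on :: "nat set \<Rightarrow> (nat \<Rightarrow>\<^sub>0 nat) set" where
  "cone_on I = {\<nu>. Poly_Mapping.keys \<nu> \<subseteq> I}"

text \<open>The homogeneous component whose first tensor factor has degree \<open>\<gamma>\<close>.\<close>

definition fst_comp :: "wt \<Rightarrow> free_alg2 \<Rightarrow> free_alg2" where
  "fst_comp \<gamma> t = (\<Sum>p\<in>{p \<in> Poly_Mapping.keys t. word_deg (fst p) = \<gamma>}.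
     Poly_Mapping.single p (Poly_Mapping.lookup t p))"

text \<open>
  For \<open>\<Theta>\<^sub>I = \<Sum>\<nu>\<in>cone_on I. \<Theta>\<^sub>\<nu>\<close>, the products \<open>t \<Theta>\<^sub>I\<close> and \<open>\<Theta>\<^sub>I t\<close> live in the completion of the tensor
  square; these are their components of first degree \<open>\<gamma>\<close>, which are finite sums because \<open>\<Theta>\<^sub>\<nu>\<close>
  is homogeneous of first degree \<open>\<nu>\<close> and \<open>t\<close> has finitely many homogeneous components.
\<close>

definition left_prod_comp ::
  "((nat \<Rightarrow>\<^sub>0 nat) \<Rightarrow> free_alg2) \<Rightarrow> nat set \<Rightarrow> free_alg2 \<Rightarrow> wt \<Rightarrow> free_alg2" where
  "left_prod_comp \<Theta> I t \<gamma> =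
     (\<Sum>\<nu>\<in>{\<nu> \<in> cone_on I. fst_comp (\<gamma> - root_wt \<nu>) t \<noteq> 0}. fst_comp (\<gamma> - root_wt \<nu>) t * \<Theta> \<nu>)"

definition right_prod_comp ::
  "((nat \<Rightarrow>\<^sub>0 nat) \<Rightarrow> free_alg2) \<Rightarrow> nat set \<Rightarrow> free_alg2 \<Rightarrow> wt \<Rightarrow> free_alg2" where
  "right_prod_comp \<Theta> I t \<gamma> =
     (\<Sum>\<nu>\<in>{\<nu> \<in> cone_on I. fst_comp (\<gamma> - root_wt \<nu>) t \<noteq> 0}. \<Theta> \<nu> * fst_comp (\<gamma> - root_wt \<nu>) t)"

text \<open>
  \<open>\<Theta>\<close> consists of representatives of the components \<open>\<Theta>\<^sub>\<nu>\<close> of the quasi-R-matrices: for every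
  \<open>k \<ge> 1\<close> the partial sum over \<open>cone_on {..<k}\<close> satisfies \<open>\<Delta>(u) \<Theta> = \<Theta> bar(\<Delta>(bar u))\<close> for all \<open>u\<close> in
  the subalgebra with indices below \<open>k\<close>.
\<close>

definition quasi_R_matrix :: "((nat \<Rightarrow>\<^sub>0 nat) \<Rightarrow> free_alg2) \<Rightarrow> bool" where
  "quasi_R_matrix \<Theta> \<longleftrightarrow>
     \<Theta> 0 = 1 \<and>
     (\<forall>\<nu>. \<Theta> \<nu> \<in> pos_neg_part \<nu>) \<and>
     (\<forall>k\<ge>1. \<forall>u\<in>subalg k. \<forall>\<gamma>.
        left_prod_comp \<Theta> {..<k} (comul u) \<gamma>
          - right_prod_comp \<Theta> {..<k} (bar_alg2 (comul (bar_alg u))) \<gamma> \<in> ideal2)"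


section \<open>The tensor space\<close>

text \<open>
  \<open>\<bbbT>\<^sup>n\<close> is the part of the tensor algebra \<open>tens\<close> spanned by the words of length \<open>n\<close>, and the product
  of \<open>tens\<close> is the tensor product of vectors.
\<close>

type_synonym tens = "half list \<Rightarrow>\<^sub>0 Kq"

abbreviation MM :: "half list \<Rightarrow> tens" where
  "MM lam \<equiv> Poly_Mapping.single lam 1"

fun nat_act :: "gen \<Rightarrow> half \<Rightarrow> tens" where
  "nat_act (GE i) r =
     (if i = 0 then (if hval r = 1/2 then MM [hf (-1/2)] else 0)
      else (if hval r = of_nat i + 1/2 then MM [hf (of_nat i - 1/2)] else 0)
         + (if hval r = - of_nat i + 1/2 then MM [hf (- of_nat i - 1/2)] else 0))"
| "nat_act (GF i) r =
     (if i = 0 then (if hval r = -1/2 then MM [hf (1/2)] else 0)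
      else (if hval r = of_nat i - 1/2 then MM [hf (of_nat i + 1/2)] else 0)
         + (if hval r = - of_nat i - 1/2 then MM [hf (- of_nat i + 1/2)] else 0))"
| "nat_act (GK i) r = scale (qq powi form (alpha i) (delta r)) (MM [r])"
| "nat_act (GKi i) r = scale (qq powi (- form (alpha i) (delta r))) (MM [r])"

text \<open>
  The action of the generators on a tensor product through the comultiplication; the empty word
  carries the counit.
\<close>

fun gen_act_basis :: "gen \<Rightarrow> half list \<Rightarrow> tens" where
  "gen_act_basis (GE i) [] = 0"
| "gen_act_basis (GF i) [] = 0"
| "gen_act_basis (GK i) [] = 1"
| "gen_act_basis (GKi i) [] = 1"
| "gen_act_basis (GE i) (r # lam) =
     MM [r] * gen_act_basis (GE i) lam + nat_act (GE i) r * gen_act_basis (GKi i) lam"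
| "gen_act_basis (GF i) (r # lam) =
     nat_act (GK i) r * gen_act_basis (GF i) lam + nat_act (GF i) r * MM lam"
| "gen_act_basis (GK i) (r # lam) = nat_act (GK i) r * gen_act_basis (GK i) lam"
| "gen_act_basis (GKi i) (r # lam) = nat_act (GKi i) r * gen_act_basis (GKi i) lam"

definition gen_act :: "gen \<Rightarrow> tens \<Rightarrow> tens" where
  "gen_act g = lin_ext (gen_act_basis g)"

definition word_act :: "gen list \<Rightarrow> tens \<Rightarrow> tens" where
  "word_act w x = foldr gen_act w x"

text \<open>The action of an element of the tensor square on \<open>x \<otimes> y\<close>.\<close>

definition act2 :: "free_alg2 \<Rightarrow> tens \<Rightarrow> tens \<Rightarrow> tens" where
  "act2 t x y = (\<Sum>(v, w)\<in>Poly_Mapping.keys t.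
     scale (Poly_Mapping.lookup t (v, w)) (word_act v x * word_act w y))"

text \<open>The action of \<open>\<Sum>\<nu>\<in>cone_on I. \<Theta>\<^sub>\<nu>\<close>; only finitely many summands are nonzero.\<close>

definition Theta_act ::
  "((nat \<Rightarrow>\<^sub>0 nat) \<Rightarrow> free_alg2) \<Rightarrow> nat set \<Rightarrow> tens \<Rightarrow> tens \<Rightarrow> tens" where
  "Theta_act \<Theta> I x y = (\<Sum>\<nu>\<in>{\<nu> \<in> cone_on I. act2 (\<Theta> \<nu>) x y \<noteq> 0}. act2 (\<Theta> \<nu>) x y)"


section \<open>Bar involutions\<close>

text \<open>
  \<open>psi_fin \<Theta> {..<k}\<close> and \<open>psi_fin \<Theta> {1..<k}\<close> are the bar involutions of type C and of type A at
  level \<open>k\<close>, using the splitting \<open>\<bbbT>\<^sup>n = \<bbbT>\<^sup>n\<^sup>-\<^sup>1 \<otimes> \<bbbV>\<close>.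
\<close>

function psi_basis ::
  "((nat \<Rightarrow>\<^sub>0 nat) \<Rightarrow> free_alg2) \<Rightarrow> nat set \<Rightarrow> half list \<Rightarrow> tens" where
  "psi_basis \<Theta> I lam =
     (if length lam \<le> 1 then MM lam
      else Theta_act \<Theta> I (psi_basis \<Theta> I (butlast lam)) (MM [last lam]))"
  by auto
termination
  by (relation "measure (\<lambda>(_, _, lam). length lam)") auto

declare psi_basis.simps [simp del]

definition psi_fin ::
  "((nat \<Rightarrow>\<^sub>0 nat) \<Rightarrow> free_alg2) \<Rightarrow> nat set \<Rightarrow> tens \<Rightarrow> tens" where
  "psi_fin \<Theta> I = antilin_ext (psi_basis \<Theta> I)"

text \<open>Possibly infinite formal sums of the \<open>M\<^sub>\<lambda>\<close>, as coefficient functions.\<close>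

type_synonym fsum = "half list \<Rightarrow> Kq"

definition Lam :: "nat \<Rightarrow> half list set" where
  "Lam n = {lam. length lam = n}"

definition truncate_fsum :: "nat \<Rightarrow> nat \<Rightarrow> fsum \<Rightarrow> tens" where
  "truncate_fsum n k v = (\<Sum>lam\<in>{lam \<in> Lam n. \<forall>r\<in>set lam. \<bar>hval r\<bar> < of_nat k}. Poly_Mapping.single lam (v lam))"

definition coeff_lim :: "(nat \<Rightarrow> tens) \<Rightarrow> fsum" where
  "coeff_lim x = (\<lambda>\<mu>. THE c. \<forall>\<^sub>F k in sequentially. Poly_Mapping.lookup (x k) \<mu> = c)"

definition psi :: "((nat \<Rightarrow>\<^sub>0 nat) \<Rightarrow> free_alg2) \<Rightarrow> nat \<Rightarrow> fsum \<Rightarrow> fsum" where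
  "psi \<Theta> n v = coeff_lim (\<lambda>k. psi_fin \<Theta> {..<k} (truncate_fsum n k v))"

definition psi_a :: "((nat \<Rightarrow>\<^sub>0 nat) \<Rightarrow> free_alg2) \<Rightarrow> nat \<Rightarrow> fsum \<Rightarrow> fsum" where
  "psi_a \<Theta> n v = coeff_lim (\<lambda>k. psi_fin \<Theta> {1..<k} (truncate_fsum n k v))"


section \<open>Bruhat order and completed tensor spaces\<close>

definition bruhat_le :: "half list \<Rightarrow> half list \<Rightarrow> bool" where
  "bruhat_le \<mu> lam \<longleftrightarrow> length \<mu> = length lam \<and>
     (\<forall>r<length lam. wt_ge (\<Sum>i=r..<length lam. delta (lam ! i)) (\<Sum>i=r..<length lam. delta (\<mu> ! i))) \<and>
     (\<Sum>i<length lam. delta (lam ! i)) = (\<Sum>i<length lam. delta (\<mu> ! i))"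

definition bruhat_less :: "half list \<Rightarrow> half list \<Rightarrow> bool" where
  "bruhat_less \<mu> lam \<longleftrightarrow> bruhat_le \<mu> lam \<and> \<mu> \<noteq> lam"

definition unitri :: "nat \<Rightarrow> fsum set" where
  "unitri n = {f. \<exists>lam\<in>Lam n. f lam = 1 \<and> (\<forall>\<mu>. f \<mu> \<noteq> 0 \<longrightarrow> \<mu> = lam \<or> bruhat_less \<mu> lam)}"

text \<open>The linear span of \<open>unitri n\<close>.\<close>

definition That :: "nat \<Rightarrow> fsum set" where
  "That n = {(\<lambda>\<mu>. \<Sum>f\<in>A. c f * f \<mu>) | A c. finite A \<and> A \<subseteq> unitri n}"

definition signs :: "half list \<Rightarrow> rat list" where
  "signs lam = map (\<lambda>r. sgn (hval r)) lam"

definition That_sgn :: "rat list \<Rightarrow> fsum set" where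
  "That_sgn s = {f \<in> That (length s). \<forall>lam. f lam \<noteq> 0 \<longrightarrow> signs lam = s}"


section \<open>Canonical bases\<close>

text \<open>
  \<open>B\<close> is a topological basis of \<open>X\<close>, one of the completed spaces: every element of \<open>X\<close> is
  uniquely a coefficientwise convergent sum \<open>\<Sum>\<^sub>\<lambda> a\<^sub>\<lambda> B\<^sub>\<lambda>\<close> with \<open>\<Sum>\<^sub>\<lambda> a\<^sub>\<lambda> M\<^sub>\<lambda>\<close> in \<open>X\<close>.  Without the
  latter restriction on the coefficients uniqueness would fail, as there are infinite ascending
  Bruhat chains.
\<close>

definition topological_basis_of :: "fsum set \<Rightarrow> (half list \<Rightarrow> fsum) \<Rightarrow> bool" where
  "topological_basis_of X B \<longleftrightarrow>
     (\<forall>a\<in>X. \<forall>\<mu>. finite {lam. a lam * B lam \<mu> \<noteq> 0}) \<and>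
     bij_betw (\<lambda>a \<mu>. \<Sum>lam\<in>{lam. a lam * B lam \<mu> \<noteq> 0}. a lam * B lam \<mu>) X X"

definition canonical_basis_C ::
  "((nat \<Rightarrow>\<^sub>0 nat) \<Rightarrow> free_alg2) \<Rightarrow> nat \<Rightarrow> (half list \<Rightarrow> fsum) \<Rightarrow> bool" where
  "canonical_basis_C \<Theta> n T \<longleftrightarrow>
     topological_basis_of (That n) T \<and>
     (\<forall>lam\<in>Lam n. psi \<Theta> n (T lam) = T lam \<and> T lam lam = 1 \<and>
        (\<forall>\<mu>. \<mu> \<noteq> lam \<longrightarrow> T lam \<mu> \<in> (if bruhat_less \<mu> lam then qZq else {0})))"

definition canonical_basis_A ::
  "((nat \<Rightarrow>\<^sub>0 nat) \<Rightarrow> free_alg2) \<Rightarrow> rat list \<Rightarrow> (half list \<Rightarrow> fsum) \<Rightarrow> bool" where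
  "canonical_basis_A \<Theta> s T \<longleftrightarrow>
     topological_basis_of (That_sgn s) T \<and>
     (\<forall>lam. signs lam = s \<longrightarrow> psi_a \<Theta> (length s) (T lam) = T lam \<and> T lam lam = 1 \<and>
        (\<forall>\<mu>. \<mu> \<noteq> lam \<longrightarrow> T lam \<mu> \<in> (if bruhat_less \<mu> lam \<and> signs \<mu> = s then qZq else {0})))"

end

theory Submission
  imports Defs
begin

text \<open>
  Each \<open>E\<^sub>i\<close> lowers an index by 1 and each \<open>F\<^sub>i\<close> raises an index by 1; only \<open>E\<^sub>0\<close> and \<open>F\<^sub>0\<close>
  change signs, \<open>E\<^sub>0\<close> from plus to minus and \<open>F\<^sub>0\<close> from minus to plus.  In \<open>\<Theta>\<^sub>\<nu>\<close> the
  \<open>E\<close>'s act on the first \<open>n - 1\<close> tensor factors and the \<open>F\<close>'s on the last one, so the terms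
  involving \<open>\<alpha>\<^sub>0\<close> vanish on the sign sequence \<open>(-,\<dots>,-,+,\<dots>,+)\<close>: either the last factor is
  positive and \<open>F\<^sub>0\<close> kills it, or all factors are negative and \<open>E\<^sub>0\<close> kills the first ones.
  Hence the two bar involutions agree.

  The type A basis elements are therefore invariant under the type C bar involution.  The latter is
  unitriangular for the integer grading by the sum of \<open>j \<lambda>\<^sub>j\<close>, with which the Bruhat order is
  compatible, and a bar-invariant element of \<open>q\<int>[q]\<close> is zero, so the usual uniqueness argument
  identifies the two canonical bases.
\<close>

section \<open>The bar involution of the ground field\<close>

lemma eval_qinv_0 [simp]: "eval_qinv 0 = 0"
  by (simp add: eval_qinv_def)

lemma eval_qinv_pCons:
  "eval_qinv (pCons a p) = to_fract [:a:] + inverse qq * eval_qinv p"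
  by (cases "a = 0 \<and> p = 0") (auto simp: eval_qinv_def map_poly_pCons)

lemma eval_qinv_add: "eval_qinv (p + r) = eval_qinv p + eval_qinv r"
proof (induction p r rule: poly_induct2)
  case (pCons a p b r)
  have "to_fract [:a + b:] = to_fract [:a:] + to_fract [:b:]"
    using to_fract_add [of "[:a:]" "[:b:]"] by simp
  with pCons show ?case
    by (simp add: eval_qinv_pCons algebra_simps)
qed simp

lemma eval_qinv_diff: "eval_qinv (p - r) = eval_qinv p - eval_qinv r"
  using eval_qinv_add [of "p - r" r] by simp

lemma eval_qinv_smult: "eval_qinv (smult a p) = to_fract [:a:] * eval_qinv p"
proof (induction p)
  case (pCons b p)
  have "to_fract [:a * b:] = to_fract [:a:] * to_fract [:b:]"
    using to_fract_mult [of "[:a:]" "[:b:]"] by (simp add: mult.commute del: to_fract_mult)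
  with pCons show ?case
    by (simp add: eval_qinv_pCons algebra_simps)
qed simp

lemma eval_qinv_mult: "eval_qinv (p * r) = eval_qinv p * eval_qinv r"
proof (induction p)
  case (pCons a p)
  then show ?case
    by (simp add: eval_qinv_pCons eval_qinv_add eval_qinv_smult algebra_simps)
qed simp

lemma qq_nonzero [simp]: "qq \<noteq> 0"
  by (simp add: qq_def)

lemma qq_power: "qq ^ n = to_fract (monom 1 n)"
proof (induction n)
  case (Suc n)
  then show ?case
    by (simp add: qq_def monom_Suc flip: to_fract_mult)
qed simp

text \<open>Clearing denominators after \<open>q \<mapsto> q\<inverse>\<close> reverses the
  coefficients. Hence \<open>eval_qinv\<close> kills only 0, and bar-invariance of a polynomial
  becomes an identity of polynomials.\<close>

lemma eval_qinv_reflect: "qq ^ degree p * eval_qinv p = to_fract (reflect_poly p)"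
proof (induction p)
  case (pCons a p)
  show ?case
  proof (cases "p = 0")
    case False
    then have "qq ^ degree (pCons a p) * eval_qinv (pCons a p)
        = qq ^ Suc (degree p) * to_fract [:a:] + qq ^ degree p * eval_qinv p"
      by (simp add: eval_qinv_pCons algebra_simps)
    also have "\<dots> = to_fract (monom 1 (Suc (degree p)) * [:a:] + reflect_poly p)"
      using pCons.IH by (simp only: qq_power to_fract_add to_fract_mult)
    also have "monom 1 (Suc (degree p)) * [:a:] = monom a (Suc (degree p))"
      by (simp add: smult_monom)
    finally show ?thesis
      using False by (simp add: reflect_poly_pCons' add.commute)
  qed (simp add: eval_qinv_pCons)
qed simp

lemma eval_qinv_eq_0_iff [simp]: "eval_qinv p = 0 \<longleftrightarrow> p = 0"
proof
  assume "eval_qinv p = 0"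
  with eval_qinv_reflect [of p] have "to_fract (reflect_poly p) = 0"
    by simp
  then show "p = 0"
    by simp
qed simp

text \<open>\<open>bar\<close> is defined on the normalised representative, but computations produce
  arbitrary ones. Cross-multiplying two representatives gives a polynomial identity;
  \<open>eval_qinv\<close> is multiplicative and sends no nonzero denominator to 0, so the choice is
  immaterial.\<close>

lemma bar_fract:
  assumes "b \<noteq> 0"
  shows "bar (to_fract a / to_fract b) = eval_qinv a / eval_qinv b"
proof -
  obtain c d where cd: "quot_of_fract (to_fract a / to_fract b) = (c, d)"
    by fastforce
  have d: "d \<noteq> 0"
    using snd_quot_of_fract_nonzero [of "to_fract a / to_fract b"] cd by simp
  have "to_fract c / to_fract d = to_fract a / to_fract b"
    using quot_to_fract_quot_of_fract [of "to_fract a / to_fract b"]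
    by (simp only: cd quot_to_fract_def prod.case Fract_conv_to_fract)
  with d assms have "to_fract (c * b) = to_fract (a * d)"
    by (simp add: field_simps)
  then have "c * b = a * d"
    by (simp only: to_fract_eq_iff)
  then have "eval_qinv c * eval_qinv b = eval_qinv a * eval_qinv d"
    by (simp flip: eval_qinv_mult)
  with d assms show ?thesis
    by (simp add: bar_def cd field_simps)
qed

lemma bar_diff: "bar (x - y) = bar x - bar y"
proof -
  obtain a b c d where x: "x = to_fract a / to_fract b" "b \<noteq> 0"
    and y: "y = to_fract c / to_fract d" "d \<noteq> 0"
    by (metis Fract_cases Fract_conv_to_fract)
  have "x - y = to_fract (a * d - c * b) / to_fract (b * d)"
    unfolding x(1) y(1) using x(2) y(2) by (simp add: diff_frac_eq)
  then have "bar (x - y) = eval_qinv (a * d - c * b) / eval_qinv (b * d)"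
    using x(2) y(2) by (simp only: bar_fract mult_eq_0_iff simp_thms)
  also have "\<dots> = bar x - bar y"
    unfolding x(1) y(1) using x(2) y(2)
    by (simp add: bar_fract eval_qinv_mult eval_qinv_diff diff_frac_eq)
  finally show ?thesis .
qed

lemma bar_0 [simp]: "bar 0 = 0"
  by (simp add: bar_def)

lemma zero_in_qZq [simp]: "0 \<in> qZq"
  unfolding qZq_def by (intro CollectI exI [of _ 0]) simp

lemma diff_in_qZq:
  assumes "x \<in> qZq" "y \<in> qZq"
  shows "x - y \<in> qZq"
proof -
  obtain p r :: "int poly" where "x = qq * to_fract (map_poly of_int p)"
    "y = qq * to_fract (map_poly of_int r)"
    using assms by (auto simp: qZq_def)
  moreover have "map_poly of_int (p - r) = map_poly of_int p - (map_poly of_int r :: rat poly)"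
    by (rule poly_eqI) (simp add: coeff_map_poly)
  ultimately have "x - y = qq * to_fract (map_poly of_int (p - r))"
    by (simp add: right_diff_distrib)
  then show ?thesis
    by (auto simp: qZq_def)
qed

text \<open>Let \<open>x\<close> be the polynomial \<open>c\<close>, which has constant term 0.
  Invariance says that the reflection of \<open>c\<close>, of degree at most
  \<open>degree c\<close>, equals \<open>q ^ degree c * c\<close>, of degree
  \<open>2 * degree c\<close> unless \<open>c = 0\<close>. So \<open>c\<close> is constant, hence
  0.\<close>

lemma bar_fixed_qZq:
  assumes "x \<in> qZq" "bar x = x"
  shows "x = 0"
proof -
  obtain p where x: "x = to_fract (pCons 0 p)"
    using assms(1) by (auto simp: qZq_def qq_def simp flip: to_fract_mult)
  let ?c = "pCons 0 p"
  have "eval_qinv ?c = to_fract ?c"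
    using assms(2) bar_fract [of 1 ?c] eval_qinv_pCons [of 1 0] by (simp add: x flip: one_pCons)
  then have "to_fract (reflect_poly ?c) = to_fract (monom 1 (degree ?c) * ?c)"
    using eval_qinv_reflect [of ?c] by (simp only: qq_power to_fract_mult)
  then have eq: "reflect_poly ?c = monom 1 (degree ?c) * ?c"
    by (simp only: to_fract_eq_iff)
  have "?c = 0"
  proof (rule ccontr)
    assume "?c \<noteq> 0"
    then have "degree (monom 1 (degree ?c) * ?c) = degree ?c + degree ?c"
      by (simp add: degree_mult_eq degree_monom_eq)
    then have "degree ?c = 0"
      using degree_reflect_poly_le [of ?c] eq by simp
    with \<open>?c \<noteq> 0\<close> show False
      by (simp split: if_splits)
  qed
  then show ?thesis
    by (simp add: x)
qed

section \<open>Half-integers and weights\<close>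

text \<open>Doubling turns half-integers into integers, so weights can be evaluated in
  \<open>int\<close>; the floor only changes the type.\<close>

definition ival :: "half \<Rightarrow> int" where
  "ival r = \<lfloor>2 * hval r\<rfloor>"

lemma of_int_ival: "of_int (ival r) = 2 * hval r"
proof -
  have "hval r - 1/2 \<in> \<int>"
    using hval [of r] by simp
  then obtain z where "hval r - 1/2 = of_int z"
    by (auto elim: Ints_cases)
  then have "2 * hval r = of_int (2 * z + 1)"
    by simp
  then show ?thesis
    by (simp only: ival_def floor_of_int)
qed

lemma hval_ival: "hval r = of_int (ival r) / 2"
  by (simp add: of_int_ival)

lemma ival_inject: "ival r = ival r' \<longleftrightarrow> r = r'"
  by (metis hval_inject hval_ival)

lemma hval_hf: "x - 1/2 \<in> \<int> \<Longrightarrow> hval (hf x) = x"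
  by (rule hf_inverse) simp

lemma hval_hf_uminus: "hval (hf (- hval r)) = - hval r"
proof (rule hval_hf)
  have "hval r - 1/2 \<in> \<int>"
    using hval [of r] by simp
  then have "- (hval r - 1/2) - 1 \<in> \<int>"
    by (intro Ints_diff [OF Ints_minus Ints_1])
  then show "- hval r - 1/2 \<in> \<int>"
    by (simp add: algebra_simps)
qed

lemma half_plus_int_eqs:
  "hval (hf (1/2)) = 1/2" "hval (hf (-1/2)) = -1/2"
  "hval (hf (of_nat i - 1/2)) = of_nat i - 1/2"
  "hval (hf (of_nat i + 1/2)) = of_nat i + 1/2"
  "hval (hf (- of_nat i - 1/2)) = - of_nat i - 1/2"
  "hval (hf (- of_nat i + 1/2)) = - of_nat i + 1/2"
proof -
  have "of_nat i - 1 \<in> (\<int> :: rat set)" "- of_nat i - 1 \<in> (\<int> :: rat set)"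
    by (intro Ints_diff Ints_minus Ints_of_nat Ints_1)+
  then show "hval (hf (of_nat i - 1/2)) = of_nat i - 1/2"
    "hval (hf (- of_nat i - 1/2)) = - of_nat i - 1/2"
    by (intro hval_hf; simp)+
  show "hval (hf (of_nat i + 1/2)) = of_nat i + 1/2"
    "hval (hf (- of_nat i + 1/2)) = - of_nat i + 1/2"
    "hval (hf (1/2)) = 1/2" "hval (hf (-1/2)) = -1/2"
    by (intro hval_hf; simp)+
qed

lemma finite_bounded_half: "finite {r. \<bar>hval r\<bar> < of_nat k}"
proof (rule finite_imageD)
  have "ival ` {r. \<bar>hval r\<bar> < of_nat k} \<subseteq> {- 2 * int k..2 * int k}"
  proof clarify
    fix r assume "\<bar>hval r\<bar> < of_nat k"
    then have "\<bar>rat_of_int (ival r)\<bar> < of_int (2 * int k)"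
      by (simp add: of_int_ival)
    then have "\<bar>ival r\<bar> < 2 * int k"
      by linarith
    then show "ival r \<in> {- 2 * int k..2 * int k}"
      by auto
  qed
  then show "finite (ival ` {r. \<bar>hval r\<bar> < of_nat k})"
    by (rule finite_subset) simp
qed (simp add: inj_on_def ival_inject)

section \<open>Additive functionals on the weight lattice, used for \<open>ival\<close> and
  \<open>tail_ind\<close>\<close>

definition wt_eval :: "(half \<Rightarrow> int) \<Rightarrow> wt \<Rightarrow> int" where
  "wt_eval g f = (\<Sum>r\<in>Poly_Mapping.keys f. Poly_Mapping.lookup f r * g r)"

lemma wt_eval_superset:
  assumes "finite S" "Poly_Mapping.keys f \<subseteq> S"
  shows "wt_eval g f = (\<Sum>r\<in>S. Poly_Mapping.lookup f r * g r)"
  unfolding wt_eval_def using assms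
  by (intro sum.mono_neutral_left) (auto simp: in_keys_iff)

lemma wt_eval_0 [simp]: "wt_eval g 0 = 0"
  by (simp add: wt_eval_def)

lemma wt_eval_add: "wt_eval g (f + f') = wt_eval g f + wt_eval g f'"
proof -
  let ?S = "Poly_Mapping.keys f \<union> Poly_Mapping.keys f'"
  have "wt_eval g (f + f') = (\<Sum>r\<in>?S. Poly_Mapping.lookup (f + f') r * g r)"
    by (intro wt_eval_superset) (auto simp: in_keys_iff lookup_add)
  moreover have "wt_eval g f = (\<Sum>r\<in>?S. Poly_Mapping.lookup f r * g r)"
    "wt_eval g f' = (\<Sum>r\<in>?S. Poly_Mapping.lookup f' r * g r)"
    by (intro wt_eval_superset; simp)+
  ultimately show ?thesis
    by (simp add: lookup_add algebra_simps sum.distrib)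
qed

lemma wt_eval_uminus: "wt_eval g (- f) = - wt_eval g f"
  using wt_eval_add [of g f "- f"] by simp

lemma wt_eval_diff: "wt_eval g (f - f') = wt_eval g f - wt_eval g f'"
  using wt_eval_add [of g f "- f'"] by (simp add: wt_eval_uminus)

lemma wt_eval_sum: "wt_eval g (\<Sum>x\<in>A. h x) = (\<Sum>x\<in>A. wt_eval g (h x))"
  by (induction A rule: infinite_finite_induct) (auto simp: wt_eval_add)

lemma wt_eval_frag_cmul: "wt_eval g (frag_cmul c f) = c * wt_eval g f"
proof -
  have "wt_eval g (frag_cmul c f)
      = (\<Sum>r\<in>Poly_Mapping.keys f. Poly_Mapping.lookup (frag_cmul c f) r * g r)"
    by (intro wt_eval_superset) auto
  then show ?thesis
    by (simp add: wt_eval_def sum_distrib_left mult.assoc)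
qed

lemma wt_eval_frag_of: "wt_eval g (frag_of r) = g r"
  by (simp add: wt_eval_def)

lemma wt_eval_delta:
  "wt_eval g (delta r) = (if hval r > 0 then g r else - g (hf (- hval r)))"
  by (simp add: delta_def wt_eval_frag_of wt_eval_uminus)

text \<open>No case distinction on the sign of \<open>r\<close> survives: \<open>ival\<close> is
  odd, just as \<open>delta\<close> is.\<close>

lemma wt_eval_ival_delta: "wt_eval ival (delta r) = ival r"
proof -
  have "rat_of_int (ival (hf (- hval r))) = of_int (- ival r)"
    using hval_hf_uminus [of r] by (simp add: of_int_ival)
  then have "ival (hf (- hval r)) = - ival r"
    by (simp only: of_int_eq_iff)
  then show ?thesis
    by (simp add: wt_eval_delta)
qed

text \<open>All simple roots, \<open>\<alpha>\<^sub>0\<close> included, take the same value, so on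
  the root cone the functional is -2 times the height.\<close>

lemma wt_eval_ival_alpha: "wt_eval ival (alpha i) = -2"
proof -
  have *: "rat_of_int (ival (hf (1/2))) = of_int 1"
    "rat_of_int (ival (hf (of_nat i - 1/2))) = of_int (2 * int i - 1)"
    "rat_of_int (ival (hf (of_nat i + 1/2))) = of_int (2 * int i + 1)"
    by (simp_all add: of_int_ival half_plus_int_eqs)
  then have "ival (hf (1/2)) = 1" "ival (hf (of_nat i - 1/2)) = 2 * int i - 1"
    "ival (hf (of_nat i + 1/2)) = 2 * int i + 1"
    by (simp_all only: of_int_eq_iff)
  then show ?thesis
    by (simp add: alpha_def wt_eval_diff wt_eval_uminus wt_eval_frag_cmul wt_eval_ival_delta)
qed

lemma wt_eval_root_wt:
  "wt_eval g (root_wt \<nu>)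
    = (\<Sum>i\<in>Poly_Mapping.keys \<nu>. int (Poly_Mapping.lookup \<nu> i) * wt_eval g (alpha i))"
  by (simp add: root_wt_def wt_eval_sum wt_eval_frag_cmul)

text \<open>
  Up to the factor 2 at \<open>i = 0\<close>, evaluating at minus the indicator of the half-integers above \<open>i\<close>
  reads off the coefficient of \<open>\<alpha>\<^sub>i\<close>.
\<close>

definition tail_ind :: "nat \<Rightarrow> half \<Rightarrow> int" where
  "tail_ind i r = (if hval r > of_nat i then -1 else 0)"

lemma wt_eval_tail_ind_alpha:
  "wt_eval (tail_ind i) (alpha j) = (if i = j then if i = 0 then 2 else 1 else 0)"
proof (cases "j = 0")
  case True
  then show ?thesis
    by (auto simp: alpha_def wt_eval_uminus wt_eval_frag_cmul wt_eval_delta tail_ind_def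
        half_plus_int_eqs)
next
  case False
  \<comment> \<open>Both sides are doubled so that the comparisons become integer ones.\<close>
  have less: "rat_of_nat i < of_nat j - 1/2 \<longleftrightarrow> i < j" "rat_of_nat i < of_nat j + 1/2 \<longleftrightarrow> i \<le> j"
  proof -
    have "rat_of_nat i < of_nat j - 1/2 \<longleftrightarrow> rat_of_int (2 * int i + 1) < of_int (2 * int j)"
      "rat_of_nat i < of_nat j + 1/2 \<longleftrightarrow> rat_of_int (2 * int i) < of_int (2 * int j + 1)"
      by auto
    then show "rat_of_nat i < of_nat j - 1/2 \<longleftrightarrow> i < j"
      "rat_of_nat i < of_nat j + 1/2 \<longleftrightarrow> i \<le> j"
      unfolding of_int_less_iff by auto
  qed
  have "rat_of_nat j \<ge> 1"
    using False by (cases j) auto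
  then have pos: "rat_of_nat j - 1/2 > 0" "rat_of_nat j + 1/2 > 0"
    by linarith+
  show ?thesis
    using False pos
    by (auto simp: alpha_def wt_eval_diff wt_eval_delta half_plus_int_eqs tail_ind_def less)
qed

lemma wt_eval_tail_ind_root_wt:
  "wt_eval (tail_ind i) (root_wt \<nu>) = int (Poly_Mapping.lookup \<nu> i) * (if i = 0 then 2 else 1)"
proof -
  have "wt_eval (tail_ind i) (root_wt \<nu>) = (\<Sum>j\<in>Poly_Mapping.keys \<nu>.
      if i = j then int (Poly_Mapping.lookup \<nu> i) * (if i = 0 then 2 else 1) else 0)"
    unfolding wt_eval_root_wt by (intro sum.cong) (auto simp: wt_eval_tail_ind_alpha)
  then show ?thesis
    by (simp add: in_keys_iff)
qed

lemma wt_eval_tail_ind_word_deg_E: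
  "set v \<subseteq> range GE \<Longrightarrow> wt_eval (tail_ind i) (word_deg v)
    = int (count_list (map gen_index v) i) * (if i = 0 then 2 else 1)"
  by (induction v) (auto simp: word_deg_def wt_eval_add wt_eval_tail_ind_alpha algebra_simps)

lemma wt_eval_tail_ind_word_deg_F:
  "set w \<subseteq> range GF \<Longrightarrow> wt_eval (tail_ind i) (word_deg w)
    = - int (count_list (map gen_index w) i) * (if i = 0 then 2 else 1)"
  by (induction w)
    (auto simp: word_deg_def wt_eval_add wt_eval_uminus wt_eval_tail_ind_alpha algebra_simps)

text \<open>\<open>pos_neg_part\<close> constrains only the weights of the two words. Applying
  \<open>tail_ind i\<close> to these weights counts the letters of index \<open>i\<close>, since
  each word uses only E's or only F's; the factor 2 at \<open>i = 0\<close> cancels.\<close>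

lemma pos_neg_part_content:
  assumes "t \<in> pos_neg_part \<nu>" "(v, w) \<in> Poly_Mapping.keys t"
  shows "set v \<subseteq> range GE" "set w \<subseteq> range GF"
    "Poly_Mapping.lookup \<nu> = count_list (map gen_index v)"
    "Poly_Mapping.lookup \<nu> = count_list (map gen_index w)"
proof -
  show v: "set v \<subseteq> range GE" and w: "set w \<subseteq> range GF"
    using assms by (auto simp: pos_neg_part_def)
  have deg: "word_deg v = root_wt \<nu>" "word_deg w = - root_wt \<nu>"
    using assms by (auto simp: pos_neg_part_def)
  show "Poly_Mapping.lookup \<nu> = count_list (map gen_index v)"
  proof
    fix i
    show "Poly_Mapping.lookup \<nu> i = count_list (map gen_index v) i"
      using wt_eval_tail_ind_word_deg_E [OF v, of i] wt_eval_tail_ind_root_wt [of i \<nu>] deg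
      by (auto split: if_splits)
  qed
  show "Poly_Mapping.lookup \<nu> = count_list (map gen_index w)"
  proof
    fix i
    show "Poly_Mapping.lookup \<nu> i = count_list (map gen_index w) i"
      using wt_eval_tail_ind_word_deg_F [OF w, of i] wt_eval_tail_ind_root_wt [of i \<nu>] deg
      by (auto simp: wt_eval_uminus split: if_splits)
  qed
qed

lemma pos_neg_part_length:
  assumes "t \<in> pos_neg_part \<nu>" "(v, w) \<in> Poly_Mapping.keys t"
  shows "length v = length w"
proof -
  have "count_list (map gen_index v) = count_list (map gen_index w)"
    using pos_neg_part_content [OF assms] by simp
  then have "mset (map gen_index v) = mset (map gen_index w)"
    by (intro multiset_eqI) (simp only: count_mset)
  then show ?thesis
    by (metis length_map mset_eq_length)
qed

lemma pos_neg_part_indices: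
  assumes "t \<in> pos_neg_part \<nu>" "(v, w) \<in> Poly_Mapping.keys t"
  shows "Poly_Mapping.keys \<nu> = gen_index ` set v" "Poly_Mapping.keys \<nu> = gen_index ` set w"
proof -
  have "Poly_Mapping.keys \<nu> = set (map gen_index v)"
    by (intro set_eqI) (simp only: in_keys_iff pos_neg_part_content(3) [OF assms] count_list_0_iff
        not_not)
  then show "Poly_Mapping.keys \<nu> = gen_index ` set v"
    by simp
  have "Poly_Mapping.keys \<nu> = set (map gen_index w)"
    by (intro set_eqI) (simp only: in_keys_iff pos_neg_part_content(4) [OF assms] count_list_0_iff
        not_not)
  then show "Poly_Mapping.keys \<nu> = gen_index ` set w"
    by simp
qed

lemma pos_neg_part_E0_F0:
  assumes "t \<in> pos_neg_part \<nu>" "(v, w) \<in> Poly_Mapping.keys t"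
  shows "0 \<in> Poly_Mapping.keys \<nu> \<longleftrightarrow> GE 0 \<in> set v" "0 \<in> Poly_Mapping.keys \<nu> \<longleftrightarrow> GF 0 \<in> set w"
  using pos_neg_part_content(1,2) [OF assms]
  by (force simp: pos_neg_part_indices(1) [OF assms], 
      force simp: pos_neg_part_indices(2) [OF assms])

section \<open>The level function\<close>

text \<open>
  The sum of all suffix sums of \<open>2 \<lambda>\<close>.  Bruhat comparison is by suffix sums of weights, hence
  implies comparison of levels.
\<close>

fun level :: "half list \<Rightarrow> int" where
  "level [] = 0"
| "level (r # lam) = ival r + sum_list (map ival lam) + level lam"

text \<open>An appended entry lies in every one of the \<open>length lam + 1\<close> nonempty
  suffixes. This form matches the recursion of \<open>psi_basis\<close>, which splits off the last
  entry.\<close>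

lemma level_snoc: "level (lam @ [r]) = level lam + (int (length lam) + 1) * ival r"
  by (induction lam) (auto simp: algebra_simps)

lemma level_suffix_sums:
  "level lam = (\<Sum>r<length lam. \<Sum>i=r..<length lam. ival (lam ! i))"
proof (induction lam)
  case (Cons x lam)
  let ?f = "\<lambda>i. ival ((x # lam) ! i)"
  have "(\<Sum>i=0..<Suc (length lam). ?f i) = sum_list (map ival (x # lam))"
    by (auto simp only: sum_list_sum_nth length_map length_Cons atLeastLessThan_iff nth_map
        intro!: sum.cong)
  moreover have "(\<Sum>i=Suc r..<Suc (length lam). ?f i) = (\<Sum>i=r..<length lam. ival (lam ! i))" for r
    by (simp only: sum.shift_bounds_Suc_ivl nth_Cons_Suc)
  ultimately show ?case
    using Cons by (simp only: length_Cons sum.lessThan_Suc_shift) simp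
qed simp

text \<open>The order is reversed because simple roots evaluate to -2.\<close>

lemma wt_ge_ival:
  assumes "wt_ge f g"
  shows "wt_eval ival f \<le> wt_eval ival g"
proof -
  obtain \<nu> where "f - g = root_wt \<nu>"
    using assms by (auto simp: wt_ge_def)
  then have "wt_eval ival f - wt_eval ival g = wt_eval ival (root_wt \<nu>)"
    by (simp flip: wt_eval_diff)
  also have "\<dots> \<le> 0"
    unfolding wt_eval_root_wt by (intro sum_nonpos) (simp add: wt_eval_ival_alpha)
  finally show ?thesis
    by simp
qed

lemma bruhat_le_level:
  assumes "bruhat_le \<mu> lam"
  shows "level lam \<le> level \<mu>"
proof -
  have len: "length \<mu> = length lam"
    and ge: "\<And>r. r < length lam \<Longrightarrow>
      wt_ge (\<Sum>i=r..<length lam. delta (lam ! i)) (\<Sum>i=r..<length lam. delta (\<mu> ! i))"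
    using assms by (auto simp: bruhat_le_def)
  show ?thesis
    unfolding level_suffix_sums len
  proof (rule sum_mono)
    fix r assume "r \<in> {..<length lam}"
    then show "(\<Sum>i=r..<length lam. ival (lam ! i)) \<le> (\<Sum>i=r..<length lam. ival (\<mu> ! i))"
      using wt_ge_ival [OF ge, of r] by (simp only: wt_eval_sum wt_eval_ival_delta lessThan_iff)
  qed
qed

section \<open>Supports of the action\<close>

lemma lookup_scale [simp]: "Poly_Mapping.lookup (scale c x) a = c * Poly_Mapping.lookup x a"
  by (simp add: scale_def Poly_Mapping.map.rep_eq when_def)

lemma scale_1 [simp]: "scale 1 x = x"
  by (rule poly_mapping_eqI) simp

lemma keys_scale: "Poly_Mapping.keys (scale c x) \<subseteq> Poly_Mapping.keys x"
  by (auto simp: in_keys_iff)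

lemma keys_lin_ext:
  "Poly_Mapping.keys (lin_ext f x) \<subseteq> (\<Union>a\<in>Poly_Mapping.keys x. Poly_Mapping.keys (f a))"
  unfolding lin_ext_def by (rule order_trans [OF keys_sum]) (intro UN_mono subset_refl keys_scale)

lemma keys_times_listE:
  fixes x y :: "'a list \<Rightarrow>\<^sub>0 Kq"
  assumes "\<mu> \<in> Poly_Mapping.keys (x * y)"
  obtains a b where "a \<in> Poly_Mapping.keys x" "b \<in> Poly_Mapping.keys y" "\<mu> = a @ b"
  using assms keys_mult [of x y] by (auto simp: plus_list_def)

text \<open>Right multiplication by a one-letter word acts on basis words by the injective map
  \<open>lam \<mapsto> lam @ [r]\<close>. This evaluates the term \<open>\<Theta> 0\<close> on the
  diagonal.\<close>

lemma lookup_times_single_snoc: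
  fixes x :: "'a list \<Rightarrow>\<^sub>0 Kq"
  shows "Poly_Mapping.lookup (x * Poly_Mapping.single [r] 1) (lam @ [r]) = Poly_Mapping.lookup x lam"
proof -
  have "x = (\<Sum>a\<in>Poly_Mapping.keys x. Poly_Mapping.single a (Poly_Mapping.lookup x a))"
    by (rule poly_mapping_eqI)
      (simp add: lookup_sum lookup_single when_def in_keys_iff)
  then have "x * Poly_Mapping.single [r] 1
      = (\<Sum>a\<in>Poly_Mapping.keys x. Poly_Mapping.single a (Poly_Mapping.lookup x a))
        * Poly_Mapping.single [r] 1"
    by (rule arg_cong)
  also have "\<dots> = (\<Sum>a\<in>Poly_Mapping.keys x. Poly_Mapping.single (a @ [r]) (Poly_Mapping.lookup x a))"
    by (simp add: sum_distrib_right mult_single plus_list_def)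
  finally show ?thesis
    by (simp add: lookup_sum lookup_single when_def in_keys_iff)
qed

lemma keys_nat_act_E:
  "\<mu> \<in> Poly_Mapping.keys (nat_act (GE i) r) \<Longrightarrow> \<exists>r'. \<mu> = [r'] \<and> hval r' = hval r - 1"
  by (auto simp: half_plus_int_eqs half_plus_int_eqs [simplified] in_keys_iff lookup_add lookup_single when_def
      split: if_splits)

text \<open>The upper bound makes the sum over \<open>\<nu>\<close> finite and shows that
  \<open>F\<^sub>0\<close> cannot act on a positive index. The last clause holds because
  \<open>F\<^sub>i\<close> with \<open>i > 0\<close> moves a negative index only from
  \<open>-i - 1/2\<close> to \<open>-i + 1/2\<close>.\<close>

lemma keys_nat_act_F:
  "\<mu> \<in> Poly_Mapping.keys (nat_act (GF i) r)
    \<Longrightarrow> \<exists>r'. \<mu> = [r'] \<and> hval r' = hval r + 1 \<and> hval r' \<le> of_nat i + 1/2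
        \<and> (0 < i \<longrightarrow> hval r < 0 \<longrightarrow> hval r' < 0)"
  by (auto simp: half_plus_int_eqs half_plus_int_eqs [simplified] in_keys_iff lookup_add lookup_single when_def
      split: if_splits)

lemma keys_nat_act_Ki: "\<mu> \<in> Poly_Mapping.keys (nat_act (GKi i) r) \<Longrightarrow> \<mu> = [r]"
  by (auto simp: in_keys_iff lookup_single when_def split: if_splits)

lemma keys_gen_act_basis_Ki: "\<mu> \<in> Poly_Mapping.keys (gen_act_basis (GKi i) lam) \<Longrightarrow> \<mu> = lam"
proof (induction lam arbitrary: \<mu>)
  case (Cons r lam)
  then have "\<mu> \<in> Poly_Mapping.keys (nat_act (GKi i) r * gen_act_basis (GKi i) lam)"
    by (simp del: nat_act.simps)
  then show ?case
    using keys_nat_act_Ki Cons.IH by (metis append_Cons append_Nil keys_times_listE)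
qed (simp add: zero_list_def)

text \<open>\<open>K\<^sub>i\<inverse>\<close> is diagonal, so either term of the coproduct leaves
  one of head and tail unchanged; thus \<open>E\<^sub>i\<close> alters a single entry.\<close>

lemma keys_gen_act_basis_E_Cons:
  assumes "\<mu> \<in> Poly_Mapping.keys (gen_act_basis (GE i) (r # lam))"
  shows "(\<exists>\<mu>'\<in>Poly_Mapping.keys (gen_act_basis (GE i) lam). \<mu> = r # \<mu>')
    \<or> (\<exists>r'. [r'] \<in> Poly_Mapping.keys (nat_act (GE i) r) \<and> \<mu> = r' # lam)"
proof -
  have "\<mu> \<in> Poly_Mapping.keys (MM [r] * gen_act_basis (GE i) lam)
      \<union> Poly_Mapping.keys (nat_act (GE i) r * gen_act_basis (GKi i) lam)"
    using assms unfolding gen_act_basis.simps by (rule subsetD [OF keys_add])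
  then consider
      "\<mu> \<in> Poly_Mapping.keys (MM [r] * gen_act_basis (GE i) lam)"
    | "\<mu> \<in> Poly_Mapping.keys (nat_act (GE i) r * gen_act_basis (GKi i) lam)"
    by blast
  then show ?thesis
  proof cases
    case 1
    then show ?thesis
      by (rule keys_times_listE) auto
  next
    case 2
    then show ?thesis
    proof (rule keys_times_listE)
      fix a b
      assume "a \<in> Poly_Mapping.keys (nat_act (GE i) r)"
        "b \<in> Poly_Mapping.keys (gen_act_basis (GKi i) lam)" "\<mu> = a @ b"
      then show ?thesis
        using keys_nat_act_E [of a i r] keys_gen_act_basis_Ki [of b i lam]
        by (auto simp del: nat_act.simps)
    qed
  qed
qed

text \<open>Lowering the \<open>j\<close>-th entry by 1 lowers \<open>ival\<close> by 2 in
  \<open>j\<close> suffix sums, hence the level by \<open>2 * j\<close>, at most twice the length.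
  The entry sum is carried along because it occurs in the recursion of \<open>level\<close>.\<close>

lemma keys_gen_act_basis_E:
  assumes "\<mu> \<in> Poly_Mapping.keys (gen_act_basis (GE i) lam)"
  shows "length \<mu> = length lam \<and> sum_list (map ival \<mu>) = sum_list (map ival lam) - 2
    \<and> level lam - 2 * int (length lam) \<le> level \<mu>"
  using assms
proof (induction lam arbitrary: \<mu>)
  case (Cons r lam)
  from keys_gen_act_basis_E_Cons [OF Cons.prems] show ?case
  proof (elim disjE bexE exE conjE)
    fix \<mu>' assume "\<mu> = r # \<mu>'" "\<mu>' \<in> Poly_Mapping.keys (gen_act_basis (GE i) lam)"
    with Cons.IH show ?thesis
      by fastforce
  next
    fix r' assume \<mu>: "\<mu> = r' # lam" and "[r'] \<in> Poly_Mapping.keys (nat_act (GE i) r)"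
    then have "hval r' = hval r - 1"
      using keys_nat_act_E by blast
    then have "rat_of_int (ival r') = of_int (ival r - 2)"
      by (simp add: of_int_ival)
    then have "ival r' = ival r - 2"
      by (simp only: of_int_eq_iff)
    then show ?thesis
      by (simp add: \<mu>)
  qed
qed simp

text \<open>Lowering keeps negative entries negative, and \<open>E\<^sub>0\<close> needs an entry
  1/2 to act on.\<close>

lemma keys_gen_act_basis_E_neg:
  assumes "\<mu> \<in> Poly_Mapping.keys (gen_act_basis (GE i) lam)" "\<forall>r\<in>set lam. hval r < 0"
  shows "(\<forall>r\<in>set \<mu>. hval r < 0) \<and> i \<noteq> 0"
  using assms
proof (induction lam arbitrary: \<mu>)
  case (Cons r lam)
  from keys_gen_act_basis_E_Cons [OF Cons.prems(1)] show ?case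
  proof (elim disjE bexE exE conjE)
    fix \<mu>' assume "\<mu> = r # \<mu>'" "\<mu>' \<in> Poly_Mapping.keys (gen_act_basis (GE i) lam)"
    with Cons show ?thesis
      by auto
  next
    fix r' assume \<mu>: "\<mu> = r' # lam" and r': "[r'] \<in> Poly_Mapping.keys (nat_act (GE i) r)"
    have "hval r' = hval r - 1"
      using keys_nat_act_E [OF r'] by simp
    moreover have "i \<noteq> 0"
      using r' Cons.prems(2) by (auto split: if_splits)
    ultimately show ?thesis
      using Cons.prems(2) by (auto simp: \<mu>)
  qed
qed simp

lemma gen_act_basis_F_singleton: "gen_act_basis (GF i) [r] = nat_act (GF i) r"
proof -
  have "(MM [] :: tens) = 1"
    by (simp flip: zero_list_def)
  then show ?thesis
    by (simp only: gen_act_basis.simps mult_zero_right add_0 mult_1_right)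
qed

lemma word_act_Nil [simp]: "word_act [] x = x"
  by (simp add: word_act_def)

lemma word_act_Cons [simp]: "word_act (g # w) x = gen_act g (word_act w x)"
  by (simp add: word_act_def)

lemma keys_gen_actE:
  assumes "\<mu> \<in> Poly_Mapping.keys (gen_act g x)"
  obtains lam where "lam \<in> Poly_Mapping.keys x" "\<mu> \<in> Poly_Mapping.keys (gen_act_basis g lam)"
  using subsetD [OF keys_lin_ext assms [unfolded gen_act_def]] by blast

lemma keys_word_act_E:
  assumes "set v \<subseteq> range GE" "\<mu> \<in> Poly_Mapping.keys (word_act v x)"
  shows "\<exists>lam\<in>Poly_Mapping.keys x. length \<mu> = length lam
    \<and> level lam - 2 * int (length lam) * int (length v) \<le> level \<mu>"
  using assms
proof (induction v arbitrary: \<mu>)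
  case (Cons g v)
  then obtain i where g: "g = GE i"
    by auto
  obtain \<mu>' where "\<mu>' \<in> Poly_Mapping.keys (word_act v x)"
    and \<mu>: "\<mu> \<in> Poly_Mapping.keys (gen_act_basis (GE i) \<mu>')"
    using Cons.prems(2) by (auto simp: g elim: keys_gen_actE)
  then obtain lam where lam: "lam \<in> Poly_Mapping.keys x" "length \<mu>' = length lam"
    "level lam - 2 * int (length lam) * int (length v) \<le> level \<mu>'"
    using Cons by fastforce
  with keys_gen_act_basis_E [OF \<mu>] show ?case
    by (intro bexI [of _ lam]) (auto simp: algebra_simps)
qed auto

lemma keys_word_act_E_neg:
  assumes "set v \<subseteq> range GE" "\<mu> \<in> Poly_Mapping.keys (word_act v x)"
    "\<forall>lam\<in>Poly_Mapping.keys x. \<forall>r\<in>set lam. hval r < 0"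
  shows "(\<forall>r\<in>set \<mu>. hval r < 0) \<and> GE 0 \<notin> set v"
  using assms
proof (induction v arbitrary: \<mu>)
  case (Cons g v)
  then obtain i where g: "g = GE i"
    by auto
  obtain \<mu>' where "\<mu>' \<in> Poly_Mapping.keys (word_act v x)"
    and \<mu>: "\<mu> \<in> Poly_Mapping.keys (gen_act_basis (GE i) \<mu>')"
    using Cons.prems(2) by (auto simp: g elim: keys_gen_actE)
  with Cons keys_gen_act_basis_E_neg [OF \<mu>] show ?case
    by (auto simp: g)
qed simp

text \<open>The length of \<open>w\<close> is the total shift of the index. The second clause caps
  its end point, which bounds the length of \<open>w\<close>; the last two control
  \<open>F\<^sub>0\<close> and the sign. The head of \<open>w\<close> acts last, so the induction
  peels off the final move.\<close>

lemma keys_word_act_F: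
  assumes "set w \<subseteq> range GF" "\<mu> \<in> Poly_Mapping.keys (word_act w (MM [r]))"
  shows "\<exists>r'. \<mu> = [r'] \<and> hval r' = hval r + of_nat (length w)
    \<and> (w \<noteq> [] \<longrightarrow> (\<forall>k. (\<forall>g\<in>set w. gen_index g < k) \<longrightarrow> hval r' \<le> of_nat k))
    \<and> (0 < hval r \<longrightarrow> GF 0 \<notin> set w)
    \<and> (hval r < 0 \<longrightarrow> GF 0 \<notin> set w \<longrightarrow> hval r' < 0)"
  using assms
proof (induction w arbitrary: \<mu>)
  case (Cons g w)
  then obtain i where g: "g = GF i"
    by auto
  obtain \<mu>' where \<mu>': "\<mu>' \<in> Poly_Mapping.keys (word_act w (MM [r]))"
    and \<mu>: "\<mu> \<in> Poly_Mapping.keys (gen_act_basis (GF i) \<mu>')"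
    using Cons.prems(2) by (auto simp: g elim: keys_gen_actE)
  have "set w \<subseteq> range GF"
    using Cons.prems(1) by simp
  from Cons.IH [OF this \<mu>'] obtain r1 where r1: "\<mu>' = [r1]" "hval r1 = hval r + of_nat (length w)"
    "0 < hval r \<longrightarrow> GF 0 \<notin> set w" "hval r < 0 \<longrightarrow> GF 0 \<notin> set w \<longrightarrow> hval r1 < 0"
    by blast
  have "\<mu> \<in> Poly_Mapping.keys (nat_act (GF i) r1)"
    using \<mu> by (simp only: r1 gen_act_basis_F_singleton)
  from keys_nat_act_F [OF this] obtain r' where r': "\<mu> = [r']" "hval r' = hval r1 + 1"
    "hval r' \<le> of_nat i + 1/2" "0 < i \<longrightarrow> hval r1 < 0 \<longrightarrow> hval r' < 0"
    by blast
  \<comment> \<open>The last letter moves the index to at most \<open>i + 1/2\<close>, which lies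
    below \<open>Suc i \<le> k\<close>.\<close>
  have "hval r' \<le> of_nat k" if "\<forall>g\<in>set (g # w). gen_index g < k" for k
  proof -
    have "Suc i \<le> k"
      using that by (simp add: g)
    then have "rat_of_nat (Suc i) \<le> of_nat k"
      by (simp only: of_nat_le_iff)
    with r'(3) show ?thesis
      by simp
  qed
  \<comment> \<open>A final \<open>F\<^sub>0\<close> would start from a negative index, but indices
    only rise from the positive \<open>r\<close>.\<close>
  moreover have "i \<noteq> 0" if "0 < hval r"
  proof
    assume "i = 0"
    with r'(2,3) have "hval r1 < 0"
      by simp
    moreover have "0 \<le> rat_of_nat (length w)"
      by simp
    ultimately show False
      using r1(2) that by linarith
  qed
  ultimately show ?case
    using r1 r' by (auto simp: g)
qed auto

section \<open>The quasi-R-matrix and the bar involutions\<close>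

lemma keys_act2E:
  assumes "\<mu> \<in> Poly_Mapping.keys (act2 t x y)"
  obtains v w a b where "(v, w) \<in> Poly_Mapping.keys t" "a \<in> Poly_Mapping.keys (word_act v x)"
    "b \<in> Poly_Mapping.keys (word_act w y)" "\<mu> = a @ b"
proof -
  have "\<mu> \<in> (\<Union>p\<in>Poly_Mapping.keys t. Poly_Mapping.keys
      (case p of (v, w) \<Rightarrow> scale (Poly_Mapping.lookup t (v, w)) (word_act v x * word_act w y)))"
    using subsetD [OF keys_sum assms [unfolded act2_def]] .
  then obtain v w where vw: "(v, w) \<in> Poly_Mapping.keys t"
    and "\<mu> \<in> Poly_Mapping.keys (scale (Poly_Mapping.lookup t (v, w)) (word_act v x * word_act w y))"
    by auto
  from this(2) have "\<mu> \<in> Poly_Mapping.keys (word_act v x * word_act w y)"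
    by (rule subsetD [OF keys_scale])
  then show ?thesis
    by (rule keys_times_listE) (rule that [OF vw])
qed

lemma act2_1: "act2 1 x y = x * y"
proof -
  have one: "(1 :: free_alg2) = Poly_Mapping.single ([], []) 1"
    by (simp add: zero_prod_def zero_list_def flip: single_one)
  show ?thesis
    unfolding act2_def one by simp
qed

lemma keys_Theta_actE:
  assumes "\<mu> \<in> Poly_Mapping.keys (Theta_act \<Theta> I x y)"
  obtains \<nu> where "\<nu> \<in> cone_on I" "\<mu> \<in> Poly_Mapping.keys (act2 (\<Theta> \<nu>) x y)"
  using subsetD [OF keys_sum assms [unfolded Theta_act_def]] by blast

lemma psi_basis_singleton: "psi_basis \<Theta> I [r] = MM [r]"
  by (simp add: psi_basis.simps)

lemma psi_basis_snoc:
  "lam \<noteq> [] \<Longrightarrow> psi_basis \<Theta> I (lam @ [r]) = Theta_act \<Theta> I (psi_basis \<Theta> I lam) (MM [r])"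
  by (cases lam) (simp_all add: psi_basis.simps [of \<Theta> I "_ # _"])

lemma finite_bounded_poly_mapping:
  "finite {\<nu> :: nat \<Rightarrow>\<^sub>0 nat. Poly_Mapping.keys \<nu> \<subseteq> {..<k} \<and> (\<forall>i. Poly_Mapping.lookup \<nu> i \<le> B)}"
    (is "finite ?S")
proof (rule finite_imageD)
  have "finite {f. \<forall>i. (i \<in> {..<k} \<longrightarrow> f i \<in> {..B}) \<and> (i \<notin> {..<k} \<longrightarrow> f i = 0)}"
    by (rule finite_set_of_finite_funs) simp_all
  then show "finite (Poly_Mapping.lookup ` ?S)"
    by (rule finite_subset [rotated]) (auto simp: in_keys_iff)
qed (simp add: inj_on_def lookup_inject)

section \<open>Support, triangularity and finiteness of the action of \<Theta>\<close>

context
  fixes \<Theta> :: "(nat \<Rightarrow>\<^sub>0 nat) \<Rightarrow> free_alg2"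
  assumes quasi_R: "quasi_R_matrix \<Theta>"
begin

lemma Theta_0: "\<Theta> 0 = 1"
  using quasi_R by (simp add: quasi_R_matrix_def)

lemma Theta_pos_neg: "\<Theta> \<nu> \<in> pos_neg_part \<nu>"
  using quasi_R by (simp add: quasi_R_matrix_def)

lemma keys_act2_ThetaE:
  assumes "\<mu> \<in> Poly_Mapping.keys (act2 (\<Theta> \<nu>) x (MM [r]))"
  obtains v w a r' where "(v, w) \<in> Poly_Mapping.keys (\<Theta> \<nu>)" "\<mu> = a @ [r']"
    "a \<in> Poly_Mapping.keys (word_act v x)" "[r'] \<in> Poly_Mapping.keys (word_act w (MM [r]))"
    "set v \<subseteq> range GE" "set w \<subseteq> range GF" "length v = length w"
    "hval r' = hval r + of_nat (length w)"
proof -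
  from assms obtain v w a b where *: "(v, w) \<in> Poly_Mapping.keys (\<Theta> \<nu>)"
    "a \<in> Poly_Mapping.keys (word_act v x)" "b \<in> Poly_Mapping.keys (word_act w (MM [r]))" "\<mu> = a @ b"
    by (rule keys_act2E)
  have sub: "set v \<subseteq> range GE" "set w \<subseteq> range GF"
    using pos_neg_part_content [OF Theta_pos_neg *(1)] by simp_all
  obtain r' where r': "b = [r']" "hval r' = hval r + of_nat (length w)"
    using keys_word_act_F [OF sub(2) *(3)] by blast
  show ?thesis
    using *(3) by (intro that [OF *(1) _ *(2) _ sub pos_neg_part_length [OF Theta_pos_neg *(1)] r'(2)])
      (simp_all add: *(4) r'(1))
qed

text \<open>If \<nu> involves \<open>\<alpha>\<^sub>0\<close>, every term of
  \<open>\<Theta> \<nu>\<close> contains both \<open>E\<^sub>0\<close> and \<open>F\<^sub>0\<close>.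
  The first alternative rules out \<open>F\<^sub>0\<close>, the second
  \<open>E\<^sub>0\<close>.\<close>

lemma act2_Theta_eq_0:
  assumes "0 \<in> Poly_Mapping.keys \<nu>"
    and "0 < hval r \<or> (\<forall>lam\<in>Poly_Mapping.keys x. \<forall>r\<in>set lam. hval r < 0)"
  shows "act2 (\<Theta> \<nu>) x (MM [r]) = 0"
proof (rule ccontr)
  assume "act2 (\<Theta> \<nu>) x (MM [r]) \<noteq> 0"
  then obtain \<mu> where "\<mu> \<in> Poly_Mapping.keys (act2 (\<Theta> \<nu>) x (MM [r]))"
    by (metis all_not_in_conv keys_eq_empty)
  then obtain v w a r' where *: "(v, w) \<in> Poly_Mapping.keys (\<Theta> \<nu>)"
    "a \<in> Poly_Mapping.keys (word_act v x)" "[r'] \<in> Poly_Mapping.keys (word_act w (MM [r]))"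
    "set v \<subseteq> range GE" "set w \<subseteq> range GF"
    by (rule keys_act2_ThetaE) (rule that)
  have "GE 0 \<in> set v" "GF 0 \<in> set w"
    using pos_neg_part_E0_F0 [OF Theta_pos_neg *(1)] assms(1) by simp_all
  then show False
    using assms(2) keys_word_act_F [OF *(5) *(3)] keys_word_act_E_neg [OF *(4) *(2)] by blast
qed

lemma Theta_act_drop_0:
  assumes "0 < hval r \<or> (\<forall>lam\<in>Poly_Mapping.keys x. \<forall>r\<in>set lam. hval r < 0)"
  shows "Theta_act \<Theta> I x (MM [r]) = Theta_act \<Theta> (I - {0}) x (MM [r])"
proof -
  have "{\<nu> \<in> cone_on I. act2 (\<Theta> \<nu>) x (MM [r]) \<noteq> 0}
      = {\<nu> \<in> cone_on (I - {0}). act2 (\<Theta> \<nu>) x (MM [r]) \<noteq> 0}"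
    using act2_Theta_eq_0 [OF _ assms] by (auto simp: cone_on_def)
  then show ?thesis
    by (simp add: Theta_act_def)
qed

text \<open>The F's raise the last entry, so its sign is at risk. But negative factors exclude
  \<open>E\<^sub>0\<close> from \<open>v\<close>, hence \<open>F\<^sub>0\<close> from
  \<open>w\<close>, and the other \<open>F\<^sub>i\<close> do not cross 0.\<close>

lemma keys_Theta_act_neg:
  assumes "\<mu> \<in> Poly_Mapping.keys (Theta_act \<Theta> I x (MM [r]))"
    and "\<forall>lam\<in>Poly_Mapping.keys x. \<forall>r\<in>set lam. hval r < 0" "hval r < 0"
  shows "\<forall>r\<in>set \<mu>. hval r < 0"
proof -
  from assms(1) obtain \<nu> where "\<mu> \<in> Poly_Mapping.keys (act2 (\<Theta> \<nu>) x (MM [r]))"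
    by (rule keys_Theta_actE)
  then obtain v w a r' where *: "(v, w) \<in> Poly_Mapping.keys (\<Theta> \<nu>)" "\<mu> = a @ [r']"
    "a \<in> Poly_Mapping.keys (word_act v x)" "[r'] \<in> Poly_Mapping.keys (word_act w (MM [r]))"
    "set v \<subseteq> range GE" "set w \<subseteq> range GF"
    by (rule keys_act2_ThetaE) (rule that)
  have a: "\<forall>r\<in>set a. hval r < 0" and "GE 0 \<notin> set v"
    using keys_word_act_E_neg [OF *(5,3) assms(2)] by auto
  then have "GF 0 \<notin> set w"
    using pos_neg_part_E0_F0 [OF Theta_pos_neg *(1)] by simp
  then have "hval r' < 0"
    using keys_word_act_F [OF *(6,4)] assms(3) by auto
  with a show ?thesis
    by (simp add: *(2))
qed

lemma keys_psi_basis_neg: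
  assumes "\<mu> \<in> Poly_Mapping.keys (psi_basis \<Theta> I lam)" "\<forall>r\<in>set lam. hval r < 0"
  shows "\<forall>r\<in>set \<mu>. hval r < 0"
  using assms
proof (induction lam arbitrary: \<mu> rule: rev_induct)
  case Nil
  then show ?case
    by (simp add: psi_basis.simps)
next
  case (snoc r lam)
  show ?case
  proof (cases "lam = []")
    case True
    with snoc.prems show ?thesis
      by (simp add: psi_basis_singleton)
  next
    case False
    show ?thesis
      using snoc.prems(1) unfolding psi_basis_snoc [OF False]
      by (rule keys_Theta_act_neg) (use snoc in auto)
  qed
qed

lemma psi_basis_drop_0:
  assumes "\<forall>r\<in>set xs. hval r < 0" "\<forall>r\<in>set ys. hval r > 0"
  shows "psi_basis \<Theta> I (xs @ ys) = psi_basis \<Theta> (I - {0}) (xs @ ys)"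
proof -
  \<comment> \<open>On the negative block \<open>E\<^sub>0\<close> is what vanishes; this requires
    the partial images to stay negative.\<close>
  have neg: "psi_basis \<Theta> I xs = psi_basis \<Theta> (I - {0}) xs"
    using assms(1)
  proof (induction xs rule: rev_induct)
    case (snoc r xs)
    show ?case
    proof (cases "xs = []")
      case False
      have "\<forall>lam\<in>Poly_Mapping.keys (psi_basis \<Theta> I xs). \<forall>r\<in>set lam. hval r < 0"
        using keys_psi_basis_neg snoc.prems by auto
      with snoc show ?thesis
        by (simp add: psi_basis_snoc [OF False] Theta_act_drop_0 [of r _ I])
    qed (simp add: psi_basis_singleton)
  qed (simp add: psi_basis.simps)
  \<comment> \<open>Each further entry is positive, so \<open>F\<^sub>0\<close> vanishes on it
    whatever the earlier factors have become.\<close>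
  show ?thesis
    using assms(2)
  proof (induction ys rule: rev_induct)
    case (snoc r ys)
    show ?case
    proof (cases "xs @ ys = []")
      case False
      with snoc show ?thesis
        by (simp add: psi_basis_snoc [OF False] Theta_act_drop_0 [of r _ I] flip: append_assoc)
    qed (simp add: psi_basis_singleton)
  qed (simp add: neg)
qed

text \<open>Let \<open>N\<close> be the common length of \<open>v\<close> and \<open>w\<close>, and
  \<open>p\<close> that of \<open>lam\<close>. The E's lower the level by at most
  \<open>2 * p * N\<close>. The F's raise the last entry by \<open>N\<close>, which counts in
  \<open>p + 1\<close> suffixes and adds \<open>2 * (p + 1) * N\<close>. The net gain is at least
  \<open>2 * N\<close>.\<close>

lemma keys_Theta_act_level:
  assumes "\<mu> \<in> Poly_Mapping.keys (Theta_act \<Theta> I x (MM [r]))"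
  shows "\<exists>lam\<in>Poly_Mapping.keys x. length \<mu> = Suc (length lam)
    \<and> (\<mu> = lam @ [r] \<or> level (lam @ [r]) < level \<mu>)"
proof -
  from assms obtain \<nu> where "\<mu> \<in> Poly_Mapping.keys (act2 (\<Theta> \<nu>) x (MM [r]))"
    by (rule keys_Theta_actE)
  then obtain v w a r' where *: "\<mu> = a @ [r']" "a \<in> Poly_Mapping.keys (word_act v x)"
    "set v \<subseteq> range GE" "length v = length w" "hval r' = hval r + of_nat (length w)"
    "set w \<subseteq> range GF"
    by (rule keys_act2_ThetaE) (rule that)
  have "rat_of_int (ival r') = of_int (ival r + 2 * int (length v))"
    unfolding of_int_ival *(5) *(4) [symmetric] by (simp add: of_int_ival)
  then have r': "ival r' = ival r + 2 * int (length v)"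
    by (simp only: of_int_eq_iff)
  show ?thesis
  proof (cases "v = []")
    case True
    with r' have "r' = r"
      by (simp add: ival_inject)
    moreover have "a \<in> Poly_Mapping.keys x"
      using *(2) True by simp
    ultimately show ?thesis
      using *(1) by auto
  next
    case False
    obtain lam where lam: "lam \<in> Poly_Mapping.keys x" "length a = length lam"
      "level lam - 2 * int (length lam) * int (length v) \<le> level a"
      using keys_word_act_E [OF *(3,2)] by blast
    have "level \<mu> = level a + (int (length lam) + 1) * (ival r + 2 * int (length v))"
      by (simp only: *(1) level_snoc r' lam(2))
    also have "\<dots> = level a + 2 * int (length lam) * int (length v)
        + (int (length lam) + 1) * ival r + 2 * int (length v)"
      by (simp add: algebra_simps)
    finally have "level (lam @ [r]) + 2 * int (length v) \<le> level \<mu>"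
      using lam(3) by (simp add: level_snoc)
    with False have "level (lam @ [r]) < level \<mu>"
      by (auto simp flip: length_greater_0_conv)
    moreover have "length \<mu> = Suc (length lam)"
      using *(1) lam(2) by simp
    ultimately show ?thesis
      using lam(1) by blast
  qed
qed

lemma keys_psi_basis_level:
  assumes "\<mu> \<in> Poly_Mapping.keys (psi_basis \<Theta> I lam)"
  shows "length \<mu> = length lam \<and> (\<mu> = lam \<or> level lam < level \<mu>)"
  using assms
proof (induction lam arbitrary: \<mu> rule: rev_induct)
  case Nil
  then show ?case
    by (simp add: psi_basis.simps)
next
  case (snoc r lam)
  show ?case
  proof (cases "lam = []")
    case True
    with snoc.prems show ?thesis
      by (simp add: psi_basis_singleton)
  next
    case False
    obtain lam' where lam': "lam' \<in> Poly_Mapping.keys (psi_basis \<Theta> I lam)"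
      "length \<mu> = Suc (length lam')" "\<mu> = lam' @ [r] \<or> level (lam' @ [r]) < level \<mu>"
      using keys_Theta_act_level snoc.prems unfolding psi_basis_snoc [OF False] by blast
    with snoc.IH [OF lam'(1)] show ?thesis
      by (auto simp: level_snoc)
  qed
qed

text \<open>Needed for the diagonal coefficients, since a sum over an infinite set would be 0 by
  convention. An F-word moves the index from \<open>r\<close> to at most \<open>k\<close>, so its
  length, and with it each coefficient of \<nu>, is bounded.\<close>

lemma finite_Theta_act: "finite {\<nu> \<in> cone_on {..<k}. act2 (\<Theta> \<nu>) x (MM [r]) \<noteq> 0}"
proof (rule finite_subset [OF _ finite_bounded_poly_mapping])
  let ?B = "nat \<lceil>of_nat k - hval r\<rceil>"
  show "{\<nu> \<in> cone_on {..<k}. act2 (\<Theta> \<nu>) x (MM [r]) \<noteq> 0}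
    \<subseteq> {\<nu>. Poly_Mapping.keys \<nu> \<subseteq> {..<k} \<and> (\<forall>i. Poly_Mapping.lookup \<nu> i \<le> ?B)}"
  proof clarify
    fix \<nu> assume \<nu>: "\<nu> \<in> cone_on {..<k}" and "act2 (\<Theta> \<nu>) x (MM [r]) \<noteq> 0"
    then obtain \<mu> where "\<mu> \<in> Poly_Mapping.keys (act2 (\<Theta> \<nu>) x (MM [r]))"
      by (metis all_not_in_conv keys_eq_empty)
    then obtain v w r' where *: "(v, w) \<in> Poly_Mapping.keys (\<Theta> \<nu>)"
      "[r'] \<in> Poly_Mapping.keys (word_act w (MM [r]))" "set w \<subseteq> range GF"
      "hval r' = hval r + of_nat (length w)"
      by (rule keys_act2_ThetaE) (rule that)
    have "gen_index g < k" if "g \<in> set w" for g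
      using \<nu> that pos_neg_part_indices(2) [OF Theta_pos_neg *(1)] by (auto simp: cone_on_def)
    then have "w \<noteq> [] \<longrightarrow> hval r' \<le> of_nat k"
      using keys_word_act_F [OF *(3,2)] by auto
    then have len: "length w \<le> ?B"
      using *(4) by (cases "w = []") (auto simp: le_nat_iff le_ceiling_iff)
    have "Poly_Mapping.lookup \<nu> i \<le> ?B" for i
    proof -
      have "Poly_Mapping.lookup \<nu> i = count_list (map gen_index w) i"
        using pos_neg_part_content(4) [OF Theta_pos_neg *(1)] by simp
      also have "\<dots> \<le> length w"
        using count_le_length [of "map gen_index w" i] by simp
      finally show ?thesis
        using len by simp
    qed
    with \<nu> show "Poly_Mapping.keys \<nu> \<subseteq> {..<k} \<and> (\<forall>i. Poly_Mapping.lookup \<nu> i \<le> ?B)"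
      by (simp add: cone_on_def)
  qed
qed

text \<open>Keeping the last entry equal to \<open>r\<close> forces the F-word to be empty, hence
  \<open>\<nu> = 0\<close>, where \<Theta> is 1.\<close>

lemma lookup_Theta_act_diag:
  "Poly_Mapping.lookup (Theta_act \<Theta> {..<k} x (MM [r])) (lam @ [r]) = Poly_Mapping.lookup x lam"
proof -
  let ?S = "{\<nu> \<in> cone_on {..<k}. act2 (\<Theta> \<nu>) x (MM [r]) \<noteq> 0}"
  have off: "\<nu> = 0"
    if diag: "lam @ [r] \<in> Poly_Mapping.keys (act2 (\<Theta> \<nu>) x (MM [r]))" for \<nu>
  proof -
    from diag obtain v w a r' where *: "(v, w) \<in> Poly_Mapping.keys (\<Theta> \<nu>)" "lam @ [r] = a @ [r']"
      "hval r' = hval r + of_nat (length w)"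
      by (rule keys_act2_ThetaE) (rule that)
    then have "w = []"
      by simp
    then show ?thesis
      using pos_neg_part_indices(2) [OF Theta_pos_neg *(1)] by simp
  qed
  have "Poly_Mapping.lookup (Theta_act \<Theta> {..<k} x (MM [r])) (lam @ [r])
      = (\<Sum>\<nu>\<in>?S. Poly_Mapping.lookup (act2 (\<Theta> \<nu>) x (MM [r])) (lam @ [r]))"
    by (simp add: Theta_act_def lookup_sum)
  also have "\<dots> = (\<Sum>\<nu>\<in>{0}. Poly_Mapping.lookup (act2 (\<Theta> \<nu>) x (MM [r])) (lam @ [r]))"
    by (rule sum.mono_neutral_cong)
      (use off finite_Theta_act [of k x r] in \<open>auto simp: in_keys_iff cone_on_def\<close>)
  finally show ?thesis
    by (simp add: Theta_0 act2_1 lookup_times_single_snoc)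
qed

lemma lookup_psi_basis_diag: "Poly_Mapping.lookup (psi_basis \<Theta> {..<k} lam) lam = 1"
proof (induction lam rule: rev_induct)
  case Nil
  show ?case
    by (simp add: psi_basis.simps)
next
  case (snoc r lam)
  show ?case
  proof (cases "lam = []")
    case True
    then show ?thesis
      by (simp add: psi_basis_singleton)
  next
    case False
    show ?thesis
      unfolding psi_basis_snoc [OF False] lookup_Theta_act_diag by (rule snoc.IH)
  qed
qed

end

section \<open>Truncations of formal sums\<close>

definition half_box :: "nat \<Rightarrow> nat \<Rightarrow> half list set" where
  "half_box n k = {lam \<in> Lam n. \<forall>r\<in>set lam. \<bar>hval r\<bar> < of_nat k}"

lemma finite_half_box: "finite (half_box n k)"
proof -
  have "half_box n k = {lam. set lam \<subseteq> {r. \<bar>hval r\<bar> < of_nat k} \<and> length lam = n}"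
    by (auto simp: half_box_def Lam_def)
  then show ?thesis
    using finite_lists_length_eq [OF finite_bounded_half] by simp
qed

lemma eventually_half_box: "\<mu> \<in> Lam n \<Longrightarrow> \<forall>\<^sub>F k in sequentially. \<mu> \<in> half_box n k"
proof -
  have "\<forall>\<^sub>F k in sequentially. x < rat_of_nat k" for x
  proof -
    obtain K where K: "x < rat_of_nat K"
      using reals_Archimedean2 by blast
    have "x < of_nat k" if "K \<le> k" for k
      using K that by (meson less_le_trans of_nat_mono)
    then show ?thesis
      by (auto simp: eventually_sequentially)
  qed
  then have "\<forall>\<^sub>F k in sequentially. \<forall>r\<in>set \<mu>. \<bar>hval r\<bar> < of_nat k"
    by (simp add: eventually_ball_finite)
  then show "\<mu> \<in> Lam n \<Longrightarrow> \<forall>\<^sub>F k in sequentially. \<mu> \<in> half_box n k"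
    by (simp add: half_box_def)
qed

lemma lookup_truncate_fsum:
  "Poly_Mapping.lookup (truncate_fsum n k f) lam = (if lam \<in> half_box n k then f lam else 0)"
  unfolding truncate_fsum_def half_box_def [symmetric]
  by (auto simp: lookup_sum lookup_single when_def finite_half_box)

text \<open>The sum runs over a box independent of \<open>f\<close> instead of the support, so that
  two such expressions can be subtracted term by term.\<close>

lemma lookup_psi_fin_truncate:
  "Poly_Mapping.lookup (psi_fin \<Theta> I (truncate_fsum n k f)) \<mu>
    = (\<Sum>lam\<in>half_box n k. bar (f lam) * Poly_Mapping.lookup (psi_basis \<Theta> I lam) \<mu>)"
proof -
  have "Poly_Mapping.lookup (psi_fin \<Theta> I (truncate_fsum n k f)) \<mu>
    = (\<Sum>lam\<in>Poly_Mapping.keys (truncate_fsum n k f).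
        bar (Poly_Mapping.lookup (truncate_fsum n k f) lam)
          * Poly_Mapping.lookup (psi_basis \<Theta> I lam) \<mu>)"
    by (simp add: psi_fin_def antilin_ext_def lookup_sum)
  also have "\<dots> = (\<Sum>lam\<in>half_box n k. bar (f lam) * Poly_Mapping.lookup (psi_basis \<Theta> I lam) \<mu>)"
    by (rule sum.mono_neutral_cong_left)
      (auto simp: finite_half_box in_keys_iff lookup_truncate_fsum split: if_splits)
  finally show ?thesis .
qed

section \<open>Coefficientwise limits and comparison of the canonical bases\<close>

text \<open>
  Convergence is not needed: if neither sequence stabilises, both values are \<open>THE c. False\<close>.
\<close>

lemma coeff_lim_diff:
  assumes "\<forall>\<^sub>F k in sequentially. Poly_Mapping.lookup (x k) \<mu> - Poly_Mapping.lookup (y k) \<mu> = c"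
  shows "coeff_lim x \<mu> - coeff_lim y \<mu> = c \<or> coeff_lim x \<mu> = coeff_lim y \<mu>"
proof -
  let ?P = "\<lambda>z c. \<forall>\<^sub>F k in sequentially. Poly_Mapping.lookup (z k) \<mu> = c"
  have shift: "?P y (d - c) \<longleftrightarrow> ?P x d" for d
    by (rule eventually_subst) (use assms in eventually_elim, auto)
  have unique: "d = e" if "?P z d" "?P z e" for z d e
  proof -
    have "\<forall>\<^sub>F k in sequentially. d = e"
      using that by eventually_elim simp
    then show ?thesis
      by simp
  qed
  have lim: "coeff_lim z \<mu> = d" if "?P z d" for z d
    unfolding coeff_lim_def using that unique by blast
  show ?thesis
  proof (cases "\<exists>d. ?P x d")
    case True
    then obtain d where "?P x d" by blast
    then show ?thesis
      using lim [of x d] lim [of y "d - c"] shift [of d] by simp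
  next
    case False
    moreover have "\<not> ?P y d" for d
      using shift [of "d + c"] False by simp
    ultimately show ?thesis
      by (simp add: coeff_lim_def)
  qed
qed

text \<open>
  At an index of minimal level in the support of \<open>f - g\<close>, unitriangularity makes the coefficient of
  \<open>f - g\<close> bar-invariant.
\<close>

lemma psi_fixed_unique:
  assumes "quasi_R_matrix \<Theta>" "psi \<Theta> n f = f" "psi \<Theta> n g = g"
    and supp: "\<And>\<mu>. f \<mu> \<noteq> g \<mu> \<Longrightarrow> length \<mu> = n \<and> L \<le> level \<mu>"
    and qZq: "\<And>\<mu>. f \<mu> - g \<mu> \<in> qZq"
  shows "f = g"
proof (rule ccontr)
  assume "f \<noteq> g"
  then obtain \<mu>0 where "f \<mu>0 \<noteq> g \<mu>0"
    by blast
  \<comment> \<open>The lower bound \<open>L\<close> makes the levels on the support well-founded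
    after the shift to \<open>nat\<close>.\<close>
  then obtain \<mu> where \<mu>: "f \<mu> \<noteq> g \<mu>"
    and min: "\<And>lam. f lam \<noteq> g lam \<Longrightarrow> nat (level \<mu> - L) \<le> nat (level lam - L)"
    using ex_has_least_nat [of "\<lambda>\<mu>. f \<mu> \<noteq> g \<mu>" \<mu>0 "\<lambda>\<mu>. nat (level \<mu> - L)"] by blast
  \<comment> \<open>\<open>psi_basis\<close> strictly raises the level off the diagonal, so another
    contributing index would have smaller level than \<mu>.\<close>
  have contrib: "lam = \<mu>"
    if "f lam \<noteq> g lam" "Poly_Mapping.lookup (psi_basis \<Theta> I lam) \<mu> \<noteq> 0" for I lam
    using keys_psi_basis_level [OF assms(1), of \<mu> I lam] that min [of lam] supp [of lam] supp [OF \<mu>]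
    by (auto simp: in_keys_iff)
  let ?y = "\<lambda>h k. psi_fin \<Theta> {..<k} (truncate_fsum n k h)"
  have "Poly_Mapping.lookup (?y f k) \<mu> - Poly_Mapping.lookup (?y g k) \<mu> = bar (f \<mu> - g \<mu>)"
    if "\<mu> \<in> half_box n k" for k
  proof -
    have "Poly_Mapping.lookup (?y f k) \<mu> - Poly_Mapping.lookup (?y g k) \<mu>
      = (\<Sum>lam\<in>half_box n k. bar (f lam - g lam) * Poly_Mapping.lookup (psi_basis \<Theta> {..<k} lam) \<mu>)"
      by (simp add: lookup_psi_fin_truncate bar_diff left_diff_distrib sum_subtractf)
    also have "\<dots> = (\<Sum>lam\<in>{\<mu>}.
        bar (f lam - g lam) * Poly_Mapping.lookup (psi_basis \<Theta> {..<k} lam) \<mu>)"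
    proof (rule sum.mono_neutral_right [OF finite_half_box])
      show "\<forall>lam\<in>half_box n k - {\<mu>}.
          bar (f lam - g lam) * Poly_Mapping.lookup (psi_basis \<Theta> {..<k} lam) \<mu> = 0"
        using contrib by (metis DiffE bar_0 diff_self insertI1 mult_eq_0_iff)
    qed (use that in simp)
    finally show ?thesis
      by (simp add: lookup_psi_basis_diag [OF assms(1)])
  qed
  moreover have "\<mu> \<in> Lam n"
    using supp [OF \<mu>] by (simp add: Lam_def)
  ultimately have "\<forall>\<^sub>F k in sequentially.
      Poly_Mapping.lookup (?y f k) \<mu> - Poly_Mapping.lookup (?y g k) \<mu> = bar (f \<mu> - g \<mu>)"
    by (auto elim: eventually_mono [OF eventually_half_box])
  then have "psi \<Theta> n f \<mu> - psi \<Theta> n g \<mu> = bar (f \<mu> - g \<mu>) \<or> psi \<Theta> n f \<mu> = psi \<Theta> n g \<mu>"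
    unfolding psi_def by (rule coeff_lim_diff)
  \<comment> \<open>The alternative of equal values is excluded because \<open>f\<close> and
    \<open>g\<close> are fixed and differ at \<mu>.\<close>
  then have "bar (f \<mu> - g \<mu>) = f \<mu> - g \<mu>"
    using assms(2,3) \<mu> by simp
  then have "f \<mu> - g \<mu> = 0"
    using bar_fixed_qZq qZq by blast
  with \<mu> show False
    by simp
qed

text \<open>The two involutions agree at every level \<open>k\<close> and on every basis vector of
  the truncation, before any limit is taken.\<close>

lemma psi_eq_psi_a:
  assumes "quasi_R_matrix \<Theta>"
    and "\<And>lam. v lam \<noteq> 0 \<Longrightarrow> signs lam = replicate l (-1) @ replicate m 1"
  shows "psi \<Theta> n v = psi_a \<Theta> n v"
proof -
  have "psi_fin \<Theta> {..<k} (truncate_fsum n k v) = psi_fin \<Theta> {1..<k} (truncate_fsum n k v)" for k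
    unfolding psi_fin_def antilin_ext_def
  proof (rule sum.cong [OF refl])
    fix lam assume "lam \<in> Poly_Mapping.keys (truncate_fsum n k v)"
    then have "v lam \<noteq> 0"
      by (auto simp: in_keys_iff lookup_truncate_fsum split: if_splits)
    then have "map (\<lambda>r. sgn (hval r)) lam = replicate l (-1) @ replicate m 1"
      using assms(2) by (simp add: signs_def)
    then obtain xs ys where lam: "lam = xs @ ys" "map (\<lambda>r. sgn (hval r)) xs = replicate l (-1)"
      "map (\<lambda>r. sgn (hval r)) ys = replicate m 1"
      by (auto simp: map_eq_append_conv)
    have "sgn (hval r) = -1" if "r \<in> set xs" for r
      using arg_cong [OF lam(2), of set] that by (auto split: if_splits)
    moreover have "sgn (hval r) = 1" if "r \<in> set ys" for r
      using arg_cong [OF lam(3), of set] that by (auto split: if_splits)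
    ultimately have "psi_basis \<Theta> {..<k} lam = psi_basis \<Theta> ({..<k} - {0}) lam"
      unfolding lam(1) by (intro psi_basis_drop_0 [OF assms(1)]) (auto simp: sgn_1_neg sgn_1_pos)
    moreover have "{..<k} - {0} = {1..<k}"
      by auto
    ultimately show "scale (bar (Poly_Mapping.lookup (truncate_fsum n k v) lam)) (psi_basis \<Theta> {..<k} lam)
      = scale (bar (Poly_Mapping.lookup (truncate_fsum n k v) lam)) (psi_basis \<Theta> {1..<k} lam)"
      by simp
  qed
  then show ?thesis
    by (simp add: psi_def psi_a_def)
qed

theorem corollary4p2:
  fixes \<Theta> :: "(nat \<Rightarrow>\<^sub>0 nat) \<Rightarrow> free_alg2"
    and l m n :: nat
    and s :: "rat list"
  assumes "quasi_R_matrix \<Theta>"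
    and "n = l + m" and "n \<ge> 1"
    and "s = replicate l (-1) @ replicate m 1"
  shows "(\<forall>v\<in>That_sgn s. psi \<Theta> n v = psi_a \<Theta> n v) \<and>
    (\<forall>T Ta. canonical_basis_C \<Theta> n T \<longrightarrow> canonical_basis_A \<Theta> s Ta \<longrightarrow>
       (\<forall>lam\<in>Lam n. signs lam = s \<longrightarrow> T lam = Ta lam))"
proof (intro conjI ballI allI impI)
  fix v assume "v \<in> That_sgn s"
  then show "psi \<Theta> n v = psi_a \<Theta> n v"
    using psi_eq_psi_a [OF assms(1)] assms(4) by (auto simp: That_sgn_def)
next
  fix T Ta lam
  assume T: "canonical_basis_C \<Theta> n T" and Ta: "canonical_basis_A \<Theta> s Ta"
    and lam: "lam \<in> Lam n" "signs lam = s"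
  have T': "psi \<Theta> n (T lam) = T lam" "T lam lam = 1"
    "\<And>\<mu>. \<mu> \<noteq> lam \<Longrightarrow> T lam \<mu> \<in> (if bruhat_less \<mu> lam then qZq else {0})"
    using T lam by (auto simp: canonical_basis_C_def)
  have Ta': "psi_a \<Theta> (length s) (Ta lam) = Ta lam" "Ta lam lam = 1"
    "\<And>\<mu>. \<mu> \<noteq> lam \<Longrightarrow> Ta lam \<mu> \<in> (if bruhat_less \<mu> lam \<and> signs \<mu> = s then qZq else {0})"
    using Ta lam by (auto simp: canonical_basis_A_def)
  have "psi \<Theta> n (Ta lam) = psi_a \<Theta> n (Ta lam)"
  proof (rule psi_eq_psi_a [OF assms(1)])
    fix \<mu> assume "Ta lam \<mu> \<noteq> 0"
    then show "signs \<mu> = replicate l (-1) @ replicate m 1"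
      using Ta'(3) [of \<mu>] lam(2) assms(4) by (cases "\<mu> = lam") (auto split: if_splits)
  qed
  moreover have "length s = n"
    using assms(2,4) by simp
  ultimately have psi_Ta: "psi \<Theta> n (Ta lam) = Ta lam"
    using Ta'(1) by simp
  show "T lam = Ta lam"
  \<comment> \<open>Here \<open>L\<close> is \<open>level lam\<close>: both elements have
    coefficient 1 at \<open>lam\<close>, so their difference is supported strictly below
    \<open>lam\<close> in the Bruhat order, where levels are at least
    \<open>level lam\<close>.\<close>
  proof (rule psi_fixed_unique [OF assms(1) T'(1) psi_Ta])
    fix \<mu>
    show "T lam \<mu> - Ta lam \<mu> \<in> qZq"
    proof (cases "\<mu> = lam")
      case False
      with T'(3) [of \<mu>] Ta'(3) [of \<mu>] show ?thesis
        by (intro diff_in_qZq) (auto split: if_splits)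
    qed (simp add: T'(2) Ta'(2))
    assume "T lam \<mu> \<noteq> Ta lam \<mu>"
    then have "bruhat_less \<mu> lam"
      using T'(2) T'(3) [of \<mu>] Ta'(2) Ta'(3) [of \<mu>] by (cases "\<mu> = lam") (auto split: if_splits)
    then have "bruhat_le \<mu> lam"
      by (simp add: bruhat_less_def)
    with lam(1) bruhat_le_level show "length \<mu> = n \<and> level lam \<le> level \<mu>"
      by (auto simp: bruhat_le_def Lam_def)
  qed
qed

end
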